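(* Let $V$ be a finite graph, each vertex of which has valence at least three, and $T$ a subgraph that is a tree with one edge $e_T$ and root vertex $v_T$, and let $\mathcal{F}$ be the frontier of $T$ in $V$. For $\mathbf{d}_{\mathcal{F}}\in(\mathbb{R}^+)^{\mathcal{F}}$, if $\mathrm{Ad}(\mathbf{d}_{\mathcal{F}})\neq \emptyset$ it is an interval: $(d^-,d^+)$ or $[d^-,d^+)$. For $R\geq 0$, $D_R(T,\mathbf{d})$ attains its minimum (over $\mathbf d=(\mathbf d_{\mathcal E},\mathbf d_{\mathcal F})$ with $\mathbf d_{\mathcal E}\in\overline{\mathrm{Ad}}(\mathbf d_{\mathcal F})$) at $\mathbf{d}= (d^-,\mathbf{d}_{\mathcal{F}})$, which satisfies one of: (1) $P_v(\mathbf{d})\in\widetilde{\mathcal{BC}}_n$, where $n$ is the valence in $V$ of the initial vertex $v$ of $e_T$ (the endpoint of $e_T$ other than $v_T$); or (2) $P_{v_T}(\mathbf{d})\in\widetilde{\mathcal{BC}}_{n_T}$, where $n_T$ is the valence of $v_T$ in $V$. In case (2), $d^-$ is not the largest side length of $P_{v_T}(\mathbf{d})$.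
   Context: Cyclic polygons. A compact convex polygon in $\mathbb{H}^2$ is cyclic if its vertices are equidistant from a point (its center); the common distance is its radius. For $n\ge3$ let $\widetilde{\mathcal{AC}}_n=\{(d_0,\dots,d_{n-1})\in(\mathbb{R}^+)^n : \sinh(d_i/2)<\sum_{j\ne i}\sinh(d_j/2)\ \forall i\}$; its elements are exactly the cyclically ordered side length collections of cyclic $n$-gons, each unique up to isometry. $J(\mathbf d)$ denotes the radius of the polygon represented by $\mathbf d$. For $J\ge d/2>0$ let $A_d(J)\in(0,\pi]$ be given by $\sinh J\,\sin(A_d(J)/2)=\sinh(d/2)$. $\widetilde{\mathcal C}_n$ is the set of $\mathbf d\in(\mathbb{R}^+)^n$ with $\sum_{j}A_{d_j}(d_i/2)>2\pi$ where $d_i$ is a maximal entry; equivalently, the elements of $\widetilde{\mathcal{AC}}_n$ whose polygon has its center in its interior. $\widetilde{\mathcal{BC}}_n$ is the set with $\sum_{j}A_{d_j}(d_i/2)=2\pi$; equivalently, the elements of $\widetilde{\mathcal{AC}}_n$ whose polygon has its center at the midpoint of its longest side. For $R\ge0$ and $\mathbf d\in\widetilde{\mathcal{AC}}_n$, $D_R(\mathbf d)=(n-2)\pi-\cosh R\sum_i\alpha_i$, where $\alpha_i$ are the interior angles of the cyclic polygon represented by $\mathbf d$. Trees. Let $T\subset V$ be finite graphs, $T$ a rooted tree with root $v_T$; at each vertex of $V$ a cyclic order on the edges of $V$ containing it is fixed. $\mathcal E$ is the edge set of $T$. The frontier $\mathcal F$ of $T$ is the set of pairs $(e,v)$ with $e$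 an edge of $V$ not in $T$ and $v\in e\cap T$; "$e\in\mathcal F$" means $(e,v)\in\mathcal F$ for some $v$. For $v\in T^{(0)}-\{v_T\}$, $e_v$ is the first edge of the path in $T$ from $v$ to $v_T$ (oriented with initial vertex $v$). For $v\in T^{(0)}$ let $v-1$ be the set of $w\in T^{(0)}-\{v_T\}$ such that $v$ is the endpoint of $e_w$ other than $w$. Given $\mathbf d_{\mathcal F}=(d_e\,|\,e\in\mathcal F)$ with $d_e>0$ and $\mathbf d_{\mathcal E}=(d_e\,|\,e\in\mathcal E)$, put $\mathbf d=(\mathbf d_{\mathcal E},\mathbf d_{\mathcal F})$ and $P_v(\mathbf d)=(d_{e_0},\dots,d_{e_{n-1}})$, where $e_0,\dots,e_{n-1}$ are the cyclically ordered edges of $V$ at $v$. $\mathrm{Ad}(\mathbf d_{\mathcal F})$ is the set of $\mathbf d_{\mathcal E}\in\mathbb{R}^{\mathcal E}$ such that: (i) for $v\in T^{(0)}-\{v_T\}$ of valence $n_v$ in $V$, $P_v(\mathbf d)\in\widetilde{\mathcal{AC}}_{n_v}-\widetilde{\mathcal C}_{n_v}$ has largest entry $d_{e_v}$; (ii) $P_{v_T}(\mathbf d)\in\widetilde{\mathcal C}_{n_T}$; (iii) $J(P_v(\mathbf d))>J(P_w(\mathbf d))$ for each $v\in T^{(0)}$ and $w\in v-1$. $\overline{\mathrm{Ad}}(\mathbf d_{\mathcal F})$ is its closure in $\mathbb{R}^{\mathcal E}$ (here $\mathbb{R}^{\mathcal E}=\mathbb{R}$). For $\mathbf d_{\mathcal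 E}\in\overline{\mathrm{Ad}}(\mathbf d_{\mathcal F})$, $D_R(T,\mathbf d)=\sum_{v\in T^{(0)}}D_R(P_v(\mathbf d))$. *)

theory Defs
  imports "HOL-Analysis.Analysis"
begin

section \<open>Cyclic polygons in the hyperbolic plane\<close>

text \<open>The hyperbolic plane is the hyperboloid model: the upper sheet of the set of vectors of
  Minkowski square \<open>-1\<close>, the third coordinate being the timelike one.\<close>

definition mink :: "real ^ 3 \<Rightarrow> real ^ 3 \<Rightarrow> real" where
  "mink x y = x $ 1 * y $ 1 + x $ 2 * y $ 2 - x $ 3 * y $ 3"

definition hyp_plane :: "(real ^ 3) set" where
  "hyp_plane = {x. mink x x = -1 \<and> 0 < x $ 3}"

definition hdist :: "real ^ 3 \<Rightarrow> real ^ 3 \<Rightarrow> real" where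
  "hdist x y = arcosh (- mink x y)"

text \<open>The projection of \<open>y\<close> to the tangent plane at \<open>x\<close>: for \<open>x \<noteq> y\<close> in the hyperbolic plane, it is
  a positive multiple of the initial velocity of the geodesic from \<open>x\<close> to \<open>y\<close>.\<close>

definition tangent_dir :: "real ^ 3 \<Rightarrow> real ^ 3 \<Rightarrow> real ^ 3" where
  "tangent_dir x y = y + mink x y *\<^sub>R x"

definition hangle :: "real ^ 3 \<Rightarrow> real ^ 3 \<Rightarrow> real ^ 3 \<Rightarrow> real" where
  "hangle y x z =
     (let u = tangent_dir x y; w = tangent_dir x z
      in arccos (mink u w / (sqrt (mink u u) * sqrt (mink w w))))"

text \<open>A compact convex polygon is given by the list of its vertices in counterclockwise order.
  The geodesic line through \<open>x\<close> and \<open>y\<close> consists of the points \<open>z\<close> with \<open>det (x, y, z) = 0\<close>, and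
  its two sides are distinguished by the sign of this determinant. The condition says that every
  side lies on a line having all the other vertices strictly to its left. It forces the vertices to
  be distinct.\<close>

definition convex_polygon :: "(real ^ 3) list \<Rightarrow> bool" where
  "convex_polygon xs \<longleftrightarrow>
     3 \<le> length xs \<and> set xs \<subseteq> hyp_plane \<and>
     (\<forall>i<length xs. \<forall>k<length xs. k \<noteq> i \<longrightarrow> k \<noteq> Suc i mod length xs \<longrightarrow>
        0 < det (vector [xs ! i, xs ! (Suc i mod length xs), xs ! k] :: real ^ 3 ^ 3))"

definition side_lengths :: "(real ^ 3) list \<Rightarrow> real list" where
  "side_lengths xs =
     map (\<lambda>i. hdist (xs ! i) (xs ! (Suc i mod length xs))) [0..<length xs]"

definition interior_angle :: "(real ^ 3) list \<Rightarrow> nat \<Rightarrow> real" where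
  "interior_angle xs i =
     hangle (xs ! ((i + length xs - 1) mod length xs)) (xs ! i) (xs ! (Suc i mod length xs))"

definition circumscribed :: "(real ^ 3) list \<Rightarrow> real ^ 3 \<Rightarrow> real \<Rightarrow> bool" where
  "circumscribed xs c r \<longleftrightarrow> c \<in> hyp_plane \<and> (\<forall>x\<in>set xs. hdist c x = r)"

definition cyclic_polygon :: "(real ^ 3) list \<Rightarrow> bool" where
  "cyclic_polygon xs \<longleftrightarrow> convex_polygon xs \<and> (\<exists>c r. circumscribed xs c r)"

definition polygon_radius :: "(real ^ 3) list \<Rightarrow> real" where
  "polygon_radius xs = (THE r. \<exists>c. circumscribed xs c r)"

text \<open>The cyclic polygon with given cyclically ordered side lengths is unique up to isometry, so
  the choice below is harmless.\<close>

definition represented_polygon :: "real list \<Rightarrow> (real ^ 3) list" where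
  "represented_polygon d = (SOME xs. cyclic_polygon xs \<and> side_lengths xs = d)"

definition J :: "real list \<Rightarrow> real" where
  "J d = polygon_radius (represented_polygon d)"

definition D_polygon :: "real \<Rightarrow> real list \<Rightarrow> real" where
  "D_polygon R d =
     (real (length d) - 2) * pi
     - cosh R * (\<Sum>i<length d. interior_angle (represented_polygon d) i)"

definition A :: "real \<Rightarrow> real \<Rightarrow> real" where
  "A d j = (THE a. 0 < a \<and> a \<le> pi \<and> sinh j * sin (a / 2) = sinh (d / 2))"

definition AC :: "nat \<Rightarrow> real list set" where
  "AC n = {d. 3 \<le> n \<and> length d = n \<and> (\<forall>x\<in>set d. 0 < x) \<and>
     (\<forall>i<n. sinh (d ! i / 2) < (\<Sum>j\<in>{..<n} - {i}. sinh (d ! j / 2)))}"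

definition C :: "nat \<Rightarrow> real list set" where
  "C n = {d. 3 \<le> n \<and> length d = n \<and> (\<forall>x\<in>set d. 0 < x) \<and>
     2 * pi < (\<Sum>j<n. A (d ! j) (Max (set d) / 2))}"

definition BC :: "nat \<Rightarrow> real list set" where
  "BC n = {d. 3 \<le> n \<and> length d = n \<and> (\<forall>x\<in>set d. 0 < x) \<and>
     (\<Sum>j<n. A (d ! j) (Max (set d) / 2)) = 2 * pi}"

section \<open>Finite graphs, rooted trees and admissible edge lengths\<close>

text \<open>Graphs may have loops and multiple edges; a loop has only one endpoint.\<close>

record ('v, 'e) graph =
  verts :: "'v set"
  edges :: "'e set"
  ends :: "'e \<Rightarrow> 'v set"

definition finite_graph :: "('v, 'e) graph \<Rightarrow> bool" where
  "finite_graph G \<longleftrightarrow> finite (verts G) \<and> finite (edges G) \<and>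
     (\<forall>e\<in>edges G. ends G e \<subseteq> verts G \<and> card (ends G e) \<in> {1, 2})"

definition incidence :: "('v, 'e) graph \<Rightarrow> 'v \<Rightarrow> 'e \<Rightarrow> nat" where
  "incidence G v e = (if v \<notin> ends G e then 0 else if ends G e = {v} then 2 else 1)"

definition valence :: "('v, 'e) graph \<Rightarrow> 'v \<Rightarrow> nat" where
  "valence G v = (\<Sum>e\<in>edges G. incidence G v e)"

text \<open>The cyclic order at \<open>v\<close> is a listing \<open>cyc v\<close> of the edges containing \<open>v\<close>, read cyclically;
  its length is the valence of \<open>v\<close>, so a loop at \<open>v\<close> is listed twice.\<close>

definition cyclic_orders :: "('v, 'e) graph \<Rightarrow> ('v \<Rightarrow> 'e list) \<Rightarrow> bool" where
  "cyclic_orders G cyc \<longleftrightarrow>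
     (\<forall>v\<in>verts G. \<forall>e. count_list (cyc v) e = (if e \<in> edges G then incidence G v e else 0))"

definition subgraph :: "('v, 'e) graph \<Rightarrow> ('v, 'e) graph \<Rightarrow> bool" where
  "subgraph H G \<longleftrightarrow> verts H \<subseteq> verts G \<and> edges H \<subseteq> edges G \<and>
     (\<forall>e\<in>edges H. ends H e = ends G e \<and> ends H e \<subseteq> verts H)"

definition graph_path :: "('v, 'e) graph \<Rightarrow> 'v \<Rightarrow> 'v list \<times> 'e list \<Rightarrow> 'v \<Rightarrow> bool" where
  "graph_path G u p w \<longleftrightarrow>
     (case p of (vs, es) \<Rightarrow>
        length vs = Suc (length es) \<and> hd vs = u \<and> last vs = w \<and> distinct vs \<and>
        set vs \<subseteq> verts G \<and> set es \<subseteq> edges G \<and>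
        (\<forall>i<length es. ends G (es ! i) = {vs ! i, vs ! Suc i}))"

text \<open>Loops and pairs of parallel edges are cycles of length one and two.\<close>

definition graph_cycle :: "('v, 'e) graph \<Rightarrow> 'v list \<Rightarrow> 'e list \<Rightarrow> bool" where
  "graph_cycle G vs es \<longleftrightarrow>
     es \<noteq> [] \<and> length vs = length es \<and> distinct vs \<and> distinct es \<and>
     set vs \<subseteq> verts G \<and> set es \<subseteq> edges G \<and>
     (\<forall>i<length es. ends G (es ! i) = {vs ! i, vs ! (Suc i mod length vs)})"

definition is_tree :: "('v, 'e) graph \<Rightarrow> bool" where
  "is_tree T \<longleftrightarrow> verts T \<noteq> {} \<and>
     (\<forall>u\<in>verts T. \<forall>w\<in>verts T. \<exists>p. graph_path T u p w) \<and>
     \<not> (\<exists>vs es. graph_cycle T vs es)"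

definition frontier_pairs :: "('v, 'e) graph \<Rightarrow> ('v, 'e) graph \<Rightarrow> ('e \<times> 'v) set" where
  "frontier_pairs V T = {(e, v). e \<in> edges V - edges T \<and> v \<in> ends V e \<inter> verts T}"

definition first_edge :: "('v, 'e) graph \<Rightarrow> 'v \<Rightarrow> 'v \<Rightarrow> 'e" where
  "first_edge T vT v = hd (snd (THE p. graph_path T v p vT))"

definition children :: "('v, 'e) graph \<Rightarrow> 'v \<Rightarrow> 'v \<Rightarrow> 'v set" where
  "children T vT v =
     {w \<in> verts T - {vT}. w \<noteq> v \<and> ends T (first_edge T vT w) = {w, v}}"

text \<open>Frontier lengths are indexed by edges, so an edge with both ends in the tree has a single
  length; values of \<open>dF\<close> off the frontier are irrelevant.\<close>

definition join :: "('v, 'e) graph \<Rightarrow> ('e \<Rightarrow> real) \<Rightarrow> ('e \<Rightarrow> real) \<Rightarrow> 'e \<Rightarrow> real" where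
  "join T dE dF e = (if e \<in> edges T then dE e else dF e)"

definition P :: "('v \<Rightarrow> 'e list) \<Rightarrow> ('e \<Rightarrow> real) \<Rightarrow> 'v \<Rightarrow> real list" where
  "P cyc d v = map d (cyc v)"

text \<open>Points of \<open>\<real>\<^sup>\<E>\<close> are the extensional functions on the edge set of \<open>T\<close>.\<close>

definition Ad :: "('v, 'e) graph \<Rightarrow> ('v \<Rightarrow> 'e list) \<Rightarrow> ('v, 'e) graph \<Rightarrow> 'v
    \<Rightarrow> ('e \<Rightarrow> real) \<Rightarrow> ('e \<Rightarrow> real) set" where
  "Ad V cyc T vT dF =
     {dE \<in> edges T \<rightarrow>\<^sub>E UNIV.
        let d = join T dE dF in
          (\<forall>v\<in>verts T - {vT}.
             P cyc d v \<in> AC (valence V v) - C (valence V v) \<and>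
             d (first_edge T vT v) = Max (set (P cyc d v))) \<and>
          P cyc d vT \<in> C (valence V vT) \<and>
          (\<forall>v\<in>verts T. \<forall>w\<in>children T vT v. J (P cyc d w) < J (P cyc d v))}"

definition Ad_closure :: "('v, 'e) graph \<Rightarrow> ('v \<Rightarrow> 'e list) \<Rightarrow> ('v, 'e) graph \<Rightarrow> 'v
    \<Rightarrow> ('e \<Rightarrow> real) \<Rightarrow> ('e \<Rightarrow> real) set" where
  "Ad_closure V cyc T vT dF = powertop_real (edges T) closure_of Ad V cyc T vT dF"

definition D_tree :: "real \<Rightarrow> ('v \<Rightarrow> 'e list) \<Rightarrow> ('v, 'e) graph \<Rightarrow> ('e \<Rightarrow> real) \<Rightarrow> real" where
  "D_tree R cyc T d = (\<Sum>v\<in>verts T. D_polygon R (P cyc d v))"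

end

theory Submission
  imports Defs
begin

text \<open>Write \<open>x\<close> for the length of the tree edge, \<open>S\<close> and \<open>B\<close> for the sums of the central angles, in a
  circle of radius \<open>r\<close>, over the remaining sides at the two vertices. The polygon at the root has
  radius \<open>j\<close> with \<open>B j + A x j = 2 \<pi>\<close>, the other one has radius \<open>k\<close> with \<open>S k = A x k\<close>, and the
  condition \<open>k < j\<close> amounts to \<open>S j + B j > 2 \<pi>\<close>, that is, to \<open>j\<close> being smaller than the radius of the
  centered polygon with all the remaining sides. As \<open>j\<close> increases with \<open>x\<close>, this bounds \<open>x\<close>
  from above, while the other conditions bound it from below.

  With \<open>\<beta>\<close> the base angle of the isosceles triangle over a side, \<open>2 \<beta> + A / cosh r\<close> has
  \<open>r\<close>-derivative \<open>- A sinh r / cosh\<^sup>2 r\<close>. Hence the angle sum at the root is the minimum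
  over \<open>r\<close> of a Lagrangian, with multiplier \<open>1 / cosh r\<close> for the angle condition, and the angle sum
  at the other vertex is a maximum. Comparing two nearby values of \<open>x\<close> through these variational
  characterizations shows that the total angle sum decreases in \<open>x\<close> as long as \<open>k < j\<close>.\<close>

section \<open>Apex angles of isosceles triangles\<close>

text \<open>The multiplier \<open>1 / cosh r\<close> comes from a single isosceles triangle: for a
  fixed side and varying leg \<open>r\<close>, the base angle \<open>\<beta>\<close> and the apex
  angle \<open>A\<close> satisfy \<open>2 \<beta>' + A' / cosh r = 0\<close>. The obstacle is that
  the radii depend on \<open>x\<close> only implicitly, and that at the lower end of the interval a
  radius may be half of a side, where the arcsine has a vertical tangent. So nothing is
  differentiated in \<open>x\<close>; derivatives are taken in the radius alone, for fixed sides.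
  The resulting comparison of \<open>x < x'\<close> needs \<open>k' \<le> j\<close>, which is
  guaranteed only for nearby lengths; bisection carries it over to every interval on which
  \<open>k < j\<close>. At the upper endpoint \<open>k = j\<close>, and there the comparison passes
  through the polygon on all remaining sides. One fact about sines,
  \<open>sin_sum_list_scale\<close>, serves twice: it gives the uniqueness of the radius of a cyclic
  polygon, wherever its center lies, and it shows that \<open>angs as\<close> and
  \<open>ang x\<close> cross only once.\<close>

text \<open>A continuous extension of \<open>A\<close> to radii below \<open>d / 2\<close>, where its value is \<open>\<pi>\<close>.\<close>

definition ang :: "real \<Rightarrow> real \<Rightarrow> real" where
  "ang d r = 2 * arcsin (min 1 (sinh (d / 2) / sinh r))"

lemma ang_pos: "0 < d \<Longrightarrow> 0 < r \<Longrightarrow> 0 < ang d r"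
  unfolding ang_def using arcsin_less_arcsin[of 0 "min 1 (sinh (d / 2) / sinh r)"] by simp

lemma ang_le_pi: "0 < d \<Longrightarrow> 0 < r \<Longrightarrow> ang d r \<le> pi"
  unfolding ang_def using arcsin_bounded[of "min 1 (sinh (d / 2) / sinh r)"]
  by (smt (verit, best) divide_pos_pos field_sum_of_halves half_gt_zero sinh_real_pos_iff)

lemma ang_eq_pi: "0 < r \<Longrightarrow> r \<le> d / 2 \<Longrightarrow> ang d r = pi"
  unfolding ang_def by (simp add: min_def not_le divide_simps)

lemma ang_ratio:
  fixes d r :: real
  assumes "0 < d" "d / 2 \<le> r"
  shows "0 < sinh (d / 2) / sinh r" "sinh (d / 2) / sinh r \<le> 1"
  using assms by (auto simp: divide_simps)

lemma sin_ang: "0 < d \<Longrightarrow> d / 2 \<le> r \<Longrightarrow> sin (ang d r / 2) = sinh (d / 2) / sinh r"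
proof -
  assume "0 < d" "d / 2 \<le> r"
  note ratio = ang_ratio[OF this]
  have "sin (arcsin (sinh (d / 2) / sinh r)) = sinh (d / 2) / sinh r"
    using ratio by (intro sin_arcsin) linarith+
  then show ?thesis using ratio by (simp only: ang_def min_absorb2) simp
qed

lemma sinh_sin_ang: "0 < d \<Longrightarrow> d / 2 \<le> r \<Longrightarrow> sinh r * sin (ang d r / 2) = sinh (d / 2)"
  by (subst sin_ang) auto

lemma ang_unique:
  assumes "0 < r" "0 < a" "a \<le> pi" "sinh r * sin (a / 2) = sinh (d / 2)"
  shows "ang d r = a"
proof -
  have "sinh (d / 2) / sinh r = sin (a / 2)"
    using assms by (auto simp: field_simps)
  then show ?thesis
    using assms by (simp add: ang_def arcsin_sin)
qed

lemma A_eq_ang: "0 < d \<Longrightarrow> d / 2 \<le> r \<Longrightarrow> A d r = ang d r"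
  unfolding A_def
  by (rule the_equality) (auto simp: ang_pos ang_le_pi sinh_sin_ang ang_unique)

lemma ang_antimono: "0 < d \<Longrightarrow> 0 < r \<Longrightarrow> r \<le> s \<Longrightarrow> ang d s \<le> ang d r"
proof -
  assume a: "0 < d" "0 < r" "r \<le> s"
  have "sinh (d / 2) / sinh s \<le> sinh (d / 2) / sinh r"
    using a by (intro divide_left_mono) auto
  moreover have "0 < sinh (d / 2) / sinh s"
    using a by auto
  ultimately show ?thesis
    unfolding ang_def by (intro mult_left_mono arcsin_le_arcsin) auto
qed

lemma ang_strict_antimono: "0 < d \<Longrightarrow> 0 < r \<Longrightarrow> r < s \<Longrightarrow> d / 2 < s \<Longrightarrow> ang d s < ang d r"
proof -
  assume a: "0 < d" "0 < r" "r < s" "d / 2 < s"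
  have "sinh (d / 2) / sinh s < sinh (d / 2) / sinh r"
    using a by (intro divide_strict_left_mono) auto
  moreover have "0 < sinh (d / 2) / sinh s" "sinh (d / 2) / sinh s < 1"
    using a by (auto simp: divide_simps)
  ultimately show ?thesis
    unfolding ang_def by (intro mult_strict_left_mono arcsin_less_arcsin) auto
qed

lemma ang_lt_pi: "0 < d \<Longrightarrow> d / 2 < r \<Longrightarrow> ang d r < pi"
  using ang_strict_antimono[of d "d/2" r] ang_eq_pi[of "d/2" d] by simp

lemma ang_mono: "0 < r \<Longrightarrow> 0 < d \<Longrightarrow> d \<le> e \<Longrightarrow> ang d r \<le> ang e r"
proof -
  assume a: "0 < r" "0 < d" "d \<le> e"
  have "sinh (d / 2) / sinh r \<le> sinh (e / 2) / sinh r"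
    using a by (intro divide_right_mono) auto
  moreover have "0 < sinh (d / 2) / sinh r"
    using a by auto
  ultimately show ?thesis
    unfolding ang_def by (intro mult_left_mono arcsin_le_arcsin) auto
qed

lemma ang_strict_mono: "0 < r \<Longrightarrow> 0 < d \<Longrightarrow> d < e \<Longrightarrow> d / 2 < r \<Longrightarrow> ang d r < ang e r"
proof -
  assume a: "0 < r" "0 < d" "d < e" "d / 2 < r"
  have "sinh (d / 2) / sinh r < sinh (e / 2) / sinh r"
    using a by (intro divide_strict_right_mono) auto
  moreover have "0 < sinh (d / 2) / sinh r" "sinh (d / 2) / sinh r < 1"
    using a by (auto simp: divide_simps)
  ultimately show ?thesis
    unfolding ang_def by (intro mult_strict_left_mono arcsin_less_arcsin) auto
qed

lemma continuous_on_ang: "0 < d \<Longrightarrow> continuous_on {0<..} (ang d)"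
  unfolding ang_def [abs_def]
  by (intro continuous_intros) (auto simp: min_def intro: order_trans[of _ 0])

lemma continuous_on_ang_length: "0 < r \<Longrightarrow> continuous_on {0..} (\<lambda>d. ang d r)"
  unfolding ang_def
  by (intro continuous_intros) (auto simp: min_def intro: order_trans[of _ 0])

lemma filterlim_sinh_at_top: "filterlim (sinh :: real \<Rightarrow> real) at_top at_top"
proof (rule filterlim_at_top_mono)
  show "filterlim (\<lambda>x::real. x) at_top at_top" by (rule filterlim_ident)
  show "\<forall>\<^sub>F x::real in at_top. x \<le> sinh x"
    using eventually_ge_at_top[of 0]
  proof eventually_elim
    case (elim x)
    have "(\<lambda>x. sinh x - x) 0 \<le> (\<lambda>x::real. sinh x - x) x"
      by (rule DERIV_nonneg_imp_nondecreasing[OF elim])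
        (auto intro!: exI derivative_eq_intros simp: cosh_real_ge_1)
    then show ?case by simp
  qed
qed

lemma tendsto_ang_0: "0 < d \<Longrightarrow> (ang d \<longlongrightarrow> 0) at_top"
proof -
  assume "0 < d"
  have "((\<lambda>r. sinh (d / 2) / sinh r) \<longlongrightarrow> 0) at_top"
    by (intro tendsto_divide_0[OF tendsto_const] filterlim_at_top_imp_at_infinity filterlim_sinh_at_top)
  then have "((\<lambda>r. min 1 (sinh (d / 2) / sinh r)) \<longlongrightarrow> min 1 0) at_top"
    by (intro tendsto_intros)
  then have "((\<lambda>r. 2 * arcsin (min 1 (sinh (d / 2) / sinh r))) \<longlongrightarrow> 2 * arcsin 0) at_top"
    by (intro tendsto_intros isCont_tendsto_compose[of 0 arcsin] isCont_arcsin) auto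
  then show ?thesis by (simp add: ang_def [abs_def])
qed

section \<open>Sums of apex angles\<close>

definition angs :: "real list \<Rightarrow> real \<Rightarrow> real" where
  "angs ds r = (\<Sum>d\<leftarrow>ds. ang d r)"

lemma angs_Nil [simp]: "angs [] r = 0"
  by (simp add: angs_def)

lemma angs_Cons [simp]: "angs (d # ds) r = ang d r + angs ds r"
  by (simp add: angs_def)

lemma angs_append [simp]: "angs (ds @ es) r = angs ds r + angs es r"
  by (simp add: angs_def)

lemma angs_nonneg: "\<forall>d\<in>set ds. 0 < d \<Longrightarrow> 0 < r \<Longrightarrow> 0 \<le> angs ds r"
  unfolding angs_def by (intro sum_list_nonneg) (auto intro: less_imp_le ang_pos)

lemma angs_pos: "\<forall>d\<in>set ds. 0 < d \<Longrightarrow> 0 < r \<Longrightarrow> ds \<noteq> [] \<Longrightarrow> 0 < angs ds r"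
  by (cases ds) (auto simp: add_pos_nonneg ang_pos angs_nonneg)

lemma angs_antimono:
  "\<forall>d\<in>set ds. 0 < d \<Longrightarrow> 0 < r \<Longrightarrow> r \<le> s \<Longrightarrow> angs ds s \<le> angs ds r"
  unfolding angs_def by (intro sum_list_mono) (auto intro: ang_antimono)

lemma angs_strict_antimono:
  "\<forall>d\<in>set ds. 0 < d \<and> d / 2 \<le> r \<Longrightarrow> 0 < r \<Longrightarrow> r < s \<Longrightarrow> ds \<noteq> [] \<Longrightarrow> angs ds s < angs ds r"
proof -
  assume a: "\<forall>d\<in>set ds. 0 < d \<and> d / 2 \<le> r" "0 < r" "r < s" "ds \<noteq> []"
  then obtain d es where "ds = d # es" by (cases ds) auto
  with a show ?thesis
    using ang_strict_antimono[of d r s] angs_antimono[of es r s] by force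
qed

lemma continuous_on_angs: "\<forall>d\<in>set ds. 0 < d \<Longrightarrow> continuous_on {0<..} (angs ds)"
  by (induction ds) (auto simp: angs_def [abs_def] intro!: continuous_intros continuous_on_ang)

lemma tendsto_angs_0: "\<forall>d\<in>set ds. 0 < d \<Longrightarrow> (angs ds \<longlongrightarrow> 0) at_top"
  by (induction ds)
    (auto simp: angs_def [abs_def] intro!: tendsto_add_zero tendsto_ang_0)

text \<open>In the circle whose diameter is the longest side, this side alone already takes up
  \<open>pi\<close>.\<close>

lemma angs_gt_pi_half_Max:
  assumes "\<forall>d\<in>set ds. 0 < d" "2 \<le> length ds"
  shows "pi < angs ds (Max (set ds) / 2)"
proof -
  define m where "m = Max (set ds)"
  have "ds \<noteq> []" using assms(2) by auto
  then have m: "m \<in> set ds" by (simp add: m_def)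
  then have p: "0 < m" using assms by blast
  obtain as bs where ds: "ds = as @ m # bs" using split_list[OF m] by blast
  have "as @ bs \<noteq> []" using assms(2) ds by auto
  then show ?thesis
    unfolding m_def [symmetric]
    using angs_pos[of "as @ bs" "m / 2"] assms(1) p by (auto simp: ds ang_eq_pi)
qed

text \<open>Decreasing the length ratio by \<open>q\<close> decreases the sine of a sum of angles
  by less than the factor \<open>q\<close>, because the cosines increase.\<close>

lemma sin_sum_list_scale:
  fixes f g :: "'a \<Rightarrow> real"
  assumes "\<forall>d\<in>set ds. 0 < g d \<and> g d < f d \<and> f d \<le> pi / 2 \<and> sin (g d) = q * sin (f d)"
    and "sum_list (map f ds) < pi" and "0 < q"
  shows "sum_list (map g ds) \<le> sum_list (map f ds) \<and>
     0 \<le> sum_list (map g ds) \<and>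
     q * sin (sum_list (map f ds)) \<le> sin (sum_list (map g ds)) \<and>
     (2 \<le> length ds \<longrightarrow> q * sin (sum_list (map f ds)) < sin (sum_list (map g ds)))"
  using assms
proof (induction ds)
  case Nil
  then show ?case by simp
next
  case (Cons d ds)
  define s where "s = sum_list (map f ds)"
  define t where "t = sum_list (map g ds)"
  have d: "0 < g d" "g d < f d" "f d \<le> pi / 2" "sin (g d) = q * sin (f d)"
    using Cons.prems by auto
  have "sum_list (map f ds) < pi" using d Cons.prems by simp
  then have ih: "t \<le> s" "0 \<le> t" "q * sin s \<le> sin t"
    using Cons.IH Cons.prems unfolding s_def t_def by auto
  have s: "f d + s < pi" using Cons.prems by (simp add: s_def)
  have c1: "cos (f d) < cos (g d)" using d by (intro cos_monotone_0_pi) auto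
  have c2: "cos s \<le> cos t" using ih s d by (intro cos_monotone_0_pi_le) auto
  have c3: "0 \<le> cos (f d)" using d by (intro cos_ge_zero) auto
  have s1: "0 < sin (f d)" using d s by (intro sin_gt_zero) auto
  have s2: "0 \<le> sin s" using ih s d by (intro sin_ge_zero) auto
  have e1: "q * sin s * cos (f d) \<le> q * sin s * cos (g d)"
    using c1 s2 \<open>0 < q\<close> by (intro mult_left_mono) auto
  have e2: "q * sin s * cos (g d) \<le> sin t * cos (g d)"
    using ih c1 c3 by (intro mult_right_mono) auto
  have e3: "q * sin (f d) * cos s \<le> q * sin (f d) * cos t"
    using c2 s1 \<open>0 < q\<close> by (intro mult_left_mono) auto
  have eq: "q * sin (f d + s) = q * sin s * cos (f d) + q * sin (f d) * cos s"
    "sin (g d + t) = sin t * cos (g d) + q * sin (f d) * cos t"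
    by (auto simp: sin_add d algebra_simps)
  have "q * sin (f d + s) < sin (g d + t)" if ne: "ds \<noteq> []"
  proof -
    have "\<forall>d\<in>set ds. 0 < f d" using Cons.prems by fastforce
    moreover obtain a es where "ds = a # es" using ne by (cases ds) auto
    moreover from calculation have "0 \<le> sum_list (map f es)"
      by (intro sum_list_nonneg) (auto intro: less_imp_le)
    ultimately have "0 < s" unfolding s_def by (simp add: add_pos_nonneg)
    then have "0 < sin s" using s d by (intro sin_gt_zero) auto
    then have "q * sin s * cos (f d) < q * sin s * cos (g d)"
      using c1 \<open>0 < q\<close> by (intro mult_strict_left_mono) auto
    then show ?thesis using e1 e2 e3 eq by linarith
  qed
  moreover have "q * sin (f d + s) \<le> sin (g d + t)" using e1 e2 e3 eq by linarith
  ultimately show ?case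
    using d ih by (cases ds) (auto simp: s_def t_def)
qed

text \<open>Passing from radius \<open>k\<close> to \<open>j\<close> multiplies the sine of half of
  \<open>ang x\<close> by exactly \<open>q\<close>, and that of half of \<open>angs ds\<close> by
  more than \<open>q\<close>. So once the sides \<open>ds\<close> subtend at least as much as
  \<open>x\<close>, they subtend strictly more in every larger circle. The bound \<open>pi\<close>
  keeps the half angles where the sine increases.\<close>

lemma angs_crossing:
  assumes ds: "\<forall>d\<in>set ds. 0 < d \<and> d / 2 \<le> k" "2 \<le> length ds"
    and x: "0 < x" "x / 2 \<le> k" and k: "k < j"
    and le: "ang x k \<le> angs ds k" "angs ds k \<le> pi"
  shows "ang x j < angs ds j"
proof -
  have pos: "0 < k" "0 < j" using x k by auto
  define q where "q = sinh k / sinh j"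
  have q: "0 < q" using pos by (simp add: q_def)
  have scale: "sin (ang d j / 2) = q * sin (ang d k / 2)" if "0 < d" "d / 2 \<le> k" for d
    using that k pos by (subst (1 2) sin_ang) (auto simp: q_def)
  have sum: "sum_list (map (\<lambda>d. ang d r / 2) ds) = angs ds r / 2" for r
    unfolding angs_def by (induction ds) (auto simp: add_divide_distrib)
  have "q * sin (angs ds k / 2) < sin (angs ds j / 2)"
  proof -
    have "\<forall>d\<in>set ds. 0 < ang d j / 2 \<and> ang d j / 2 < ang d k / 2 \<and> ang d k / 2 \<le> pi / 2 \<and>
        sin (ang d j / 2) = q * sin (ang d k / 2)"
    proof
      fix d assume "d \<in> set ds"
      with ds have d: "0 < d" "d / 2 \<le> k" by auto
      then have "d / 2 < j" using k by linarith
      then show "0 < ang d j / 2 \<and> ang d j / 2 < ang d k / 2 \<and> ang d k / 2 \<le> pi / 2 \<and>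
          sin (ang d j / 2) = q * sin (ang d k / 2)"
        using ang_pos[of d j] ang_strict_antimono[of d k j] ang_le_pi[of d k] scale[OF d] d pos k
        by simp
    qed
    moreover have "angs ds k / 2 < pi" using le pi_gt_zero by linarith
    ultimately show ?thesis
      using sin_sum_list_scale[of ds "\<lambda>d. ang d j / 2" "\<lambda>d. ang d k / 2" q] ds(2) q
      unfolding sum by blast
  qed
  moreover have "sin (ang x k / 2) \<le> sin (angs ds k / 2)"
    using le ang_pos[of x k] x(1) pos(1) pi_gt_zero
    by (intro sin_monotone_2pi_le) linarith+
  then have "q * sin (ang x k / 2) \<le> q * sin (angs ds k / 2)"
    using q by (intro mult_left_mono) auto
  ultimately have "sin (ang x j / 2) < sin (angs ds j / 2)"
    using scale[OF x] by linarith
  moreover have "angs ds j \<le> pi"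
    using angs_antimono[of ds k j] ds(1) le(2) k pos by simp
  moreover have "0 \<le> angs ds j" using angs_nonneg[of ds j] ds(1) pos by simp
  moreover have "ang x j \<le> pi" using ang_le_pi[of x j] x(1) pos(2) by simp
  ultimately show ?thesis
    using sin_monotone_2pi_le[of "angs ds j / 2" "ang x j / 2"] pi_gt_zero
    by (cases "angs ds j \<le> ang x j") auto
qed

section \<open>Polygons inscribed in a hyperbolic circle\<close>

lemma mink_commute: "mink x y = mink y x"
  by (simp add: mink_def)

lemma mink_simps:
  "mink (x + y) z = mink x z + mink y z" "mink z (x + y) = mink z x + mink z y"
  "mink (a *\<^sub>R x) z = a * mink x z" "mink z (a *\<^sub>R x) = a * mink z x"
  "mink (x - y) z = mink x z - mink y z" "mink z (x - y) = mink z x - mink z y"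
  by (simp_all add: mink_def algebra_simps)

lemma vec3_eq_iff: "(x :: real ^ 3) = y \<longleftrightarrow> x $ 1 = y $ 1 \<and> x $ 2 = y $ 2 \<and> x $ 3 = y $ 3"
  by (simp add: vec_eq_iff forall_3)

abbreviation det3 :: "real ^ 3 \<Rightarrow> real ^ 3 \<Rightarrow> real ^ 3 \<Rightarrow> real" where
  "det3 x y z \<equiv> det (vector [x, y, z] :: real ^ 3 ^ 3)"

lemma det3_same: "det3 x x z = 0" "det3 x y x = 0" "det3 x y y = 0"
  by (simp_all add: det_3 algebra_simps)

lemma mink_hyp_plane:
  assumes "x \<in> hyp_plane" "y \<in> hyp_plane"
  shows "mink x y \<le> -1" "mink x y = -1 \<Longrightarrow> x = y"
proof -
  have x: "(x $ 3)\<^sup>2 = 1 + (x $ 1)\<^sup>2 + (x $ 2)\<^sup>2" "0 < x $ 3"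
    using assms(1) by (simp_all add: hyp_plane_def mink_def power2_eq_square)
  have y: "(y $ 3)\<^sup>2 = 1 + (y $ 1)\<^sup>2 + (y $ 2)\<^sup>2" "0 < y $ 3"
    using assms(2) by (simp_all add: hyp_plane_def mink_def power2_eq_square)
  define p where "p = 1 + x $ 1 * y $ 1 + x $ 2 * y $ 2"
  \<comment> \<open>Lagrange's identity for the two vectors made up of 1 and the first two
    coordinates: the squares of their Euclidean norms are the squares of the third coordinates,
    \<open>p\<close> is their scalar product, and the other three squares come from their cross
    product.\<close>
  have eq: "(x $ 3 * y $ 3)\<^sup>2 = p\<^sup>2 + (x $ 1 - y $ 1)\<^sup>2 + (x $ 2 - y $ 2)\<^sup>2
      + (x $ 1 * y $ 2 - x $ 2 * y $ 1)\<^sup>2"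
    unfolding power_mult_distrib x(1) y(1) p_def by algebra
  have pos: "0 < x $ 3 * y $ 3" using x y by simp
  have le: "p\<^sup>2 \<le> (x $ 3 * y $ 3)\<^sup>2" unfolding eq by simp
  have "p \<le> x $ 3 * y $ 3" by (rule power2_le_imp_le[OF le less_imp_le[OF pos]])
  then show "mink x y \<le> -1" by (simp add: mink_def p_def)
  assume "mink x y = -1"
  then have "p = x $ 3 * y $ 3" by (simp add: mink_def p_def)
  with eq have "(x $ 1 - y $ 1)\<^sup>2 + (x $ 2 - y $ 2)\<^sup>2 + (x $ 1 * y $ 2 - x $ 2 * y $ 1)\<^sup>2 = 0"
    by simp
  then have "x $ 1 = y $ 1 \<and> x $ 2 = y $ 2"
    by (simp add: add_nonneg_eq_0_iff)
  moreover from this have "(x $ 3)\<^sup>2 = (y $ 3)\<^sup>2" using x(1) y(1) by simp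
  then have "x $ 3 = y $ 3" using x(2) y(2) by (auto dest!: power2_eq_imp_eq)
  ultimately show "x = y" by (simp add: vec3_eq_iff)
qed

lemma cosh_hdist: "x \<in> hyp_plane \<Longrightarrow> y \<in> hyp_plane \<Longrightarrow> cosh (hdist x y) = - mink x y"
  unfolding hdist_def using mink_hyp_plane(1)[of x y] by (intro cosh_arcosh_real) simp

lemma hdist_nonneg: "x \<in> hyp_plane \<Longrightarrow> y \<in> hyp_plane \<Longrightarrow> 0 \<le> hdist x y"
  unfolding hdist_def using mink_hyp_plane(1)[of x y] by (intro arcosh_nonneg_real) simp

lemma cosh_double_half: "cosh (x :: real) = 1 + 2 * (sinh (x / 2))\<^sup>2"
  using cosh_double_cosh[of "x / 2"] cosh_square_eq[of "x / 2"] by simp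

lemma sinh_half_hdist:
  assumes "x \<in> hyp_plane" "y \<in> hyp_plane" "- mink x y = 1 + 2 * t\<^sup>2" "0 \<le> t"
  shows "sinh (hdist x y / 2) = t"
proof -
  have "(sinh (hdist x y / 2))\<^sup>2 = t\<^sup>2"
    using cosh_hdist[OF assms(1,2)] cosh_double_half[of "hdist x y"] assms(3) by linarith
  then show ?thesis
    by (rule power2_eq_imp_eq) (use hdist_nonneg[OF assms(1,2)] assms(4) in simp_all)
qed

text \<open>Base angle of the isosceles triangle with apex angle \<open>a\<close> and legs
  \<open>r\<close>: the altitude cuts off a right triangle in which \<open>cosh r\<close> is the
  product of the cotangents of the acute angles. For \<open>a > pi\<close> the value is negative, as
  it should be for a side that separates the polygon from its center.\<close>

definition base :: "real \<Rightarrow> real \<Rightarrow> real" where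
  "base a r = arctan (cot (a / 2) / cosh r)"

lemma base_flip: "base (2 * pi - a) r = - base a r"
proof -
  have "cot (pi - a / 2) = - cot (a / 2)" by (simp add: cot_def)
  then have "cot ((2 * pi - a) / 2) = - cot (a / 2)" by (simp add: diff_divide_distrib)
  then show ?thesis by (simp add: base_def arctan_minus)
qed

text \<open>The square root is the hyperbolic cosine of half the chord, whose hyperbolic sine is
  \<open>sinh r * sin p\<close>. The case \<open>p > pi / 2\<close>, with negative
  \<open>base\<close>, is included.\<close>

lemma base_sin_cos:
  fixes p r :: real
  assumes "0 < p" "p < pi"
  shows "sqrt (1 + (sinh r)\<^sup>2 * (sin p)\<^sup>2) * sin (base (2 * p) r) = cos p"
    and "sqrt (1 + (sinh r)\<^sup>2 * (sin p)\<^sup>2) * cos (base (2 * p) r) = cosh r * sin p"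
proof -
  have s: "0 < sin p" using assms by (rule sin_gt_zero)
  define y where "y = cot p / cosh r"
  define w where "w = sqrt (1 + (sinh r)\<^sup>2 * (sin p)\<^sup>2)"
  have w0: "0 < w" unfolding w_def by (simp add: add_pos_nonneg)
  have eq: "sqrt (1 + y\<^sup>2) = w / (cosh r * sin p)"
  proof (rule real_sqrt_unique)
    have c: "(cos p)\<^sup>2 = 1 - (sin p)\<^sup>2" "(cosh r)\<^sup>2 = 1 + (sinh r)\<^sup>2"
      by (simp_all add: cos_squared_eq cosh_square_eq)
    have "(w / (cosh r * sin p))\<^sup>2 = (1 + (sinh r)\<^sup>2 * (sin p)\<^sup>2) / ((cosh r)\<^sup>2 * (sin p)\<^sup>2)"
      by (simp add: w_def power_divide power_mult_distrib)
    also have "1 + (sinh r)\<^sup>2 * (sin p)\<^sup>2 = (cosh r)\<^sup>2 * (sin p)\<^sup>2 + (cos p)\<^sup>2"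
      by (simp add: c algebra_simps)
    also have "\<dots> / ((cosh r)\<^sup>2 * (sin p)\<^sup>2) = 1 + (cos p)\<^sup>2 / ((cosh r)\<^sup>2 * (sin p)\<^sup>2)"
      using s by (simp add: add_divide_distrib)
    also have "\<dots> = 1 + y\<^sup>2"
      by (simp add: y_def cot_def power_divide power_mult_distrib mult.commute)
    finally show "(w / (cosh r * sin p))\<^sup>2 = 1 + y\<^sup>2" .
  qed (use w0 s in simp)
  have b: "base (2 * p) r = arctan y" by (simp add: base_def y_def)
  show "sqrt (1 + (sinh r)\<^sup>2 * (sin p)\<^sup>2) * sin (base (2 * p) r) = cos p"
    unfolding w_def[symmetric] b sin_arctan eq using w0 s by (simp add: y_def cot_def)
  show "sqrt (1 + (sinh r)\<^sup>2 * (sin p)\<^sup>2) * cos (base (2 * p) r) = cosh r * sin p"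
    unfolding w_def[symmetric] b cos_arctan eq using w0 s by simp
qed

lemma base_strict_antimono: "0 < a \<Longrightarrow> a < b \<Longrightarrow> b < 2 * pi \<Longrightarrow> base b r < base a r"
proof -
  assume a: "0 < a" "a < b" "b < 2 * pi"
  have s: "0 < sin (a / 2)" "0 < sin (b / 2)" using a by (auto intro!: sin_gt_zero)
  have "0 < sin (b / 2 - a / 2)" using a by (intro sin_gt_zero) auto
  then have "cos (b / 2) * sin (a / 2) < cos (a / 2) * sin (b / 2)"
    unfolding sin_diff by (simp only: mult.commute)
  then have "cot (b / 2) < cot (a / 2)"
    using s by (simp add: cot_def divide_simps mult.commute)
  then show ?thesis
    unfolding base_def by (intro arctan_monotone divide_strict_right_mono cosh_real_pos)
qed

section \<open>Points of a circle in polar coordinates\<close>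

locale frame =
  fixes c f h :: "real ^ 3"
  assumes gram: "mink c c = -1" "mink f f = 1" "mink h h = 1"
      "mink c f = 0" "mink c h = 0" "mink f h = 0"
    and oriented: "det3 c f h = 1"
    and center: "c \<in> hyp_plane"
begin

definition pt :: "real \<Rightarrow> real \<Rightarrow> real ^ 3" where
  "pt r u = cosh r *\<^sub>R c + sinh r *\<^sub>R (cos u *\<^sub>R f + sin u *\<^sub>R h)"

lemma mink_pt_pt: "mink (pt r u) (pt r w) = - 1 - 2 * (sinh r * sin ((u - w) / 2))\<^sup>2"
proof -
  have "mink (pt r u) (pt r w) = - (cosh r)\<^sup>2 + (sinh r)\<^sup>2 * cos (u - w)"
    by (simp add: pt_def mink_simps gram mink_commute[of h f] mink_commute[of h c] mink_commute[of f c] cos_diff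
        power2_eq_square algebra_simps)
  moreover have "cos (u - w) = 1 - 2 * (sin ((u - w) / 2))\<^sup>2"
    using cos_double_sin[of "(u - w) / 2"] by (simp only: mult_2 field_sum_of_halves)
  ultimately show ?thesis by (simp add: cosh_square_eq power_mult_distrib algebra_simps)
qed

lemma mink_center_pt: "mink c (pt r u) = - cosh r"
  by (simp add: pt_def mink_simps gram)

lemma pt_in_hyp_plane: "pt r u \<in> hyp_plane"
proof -
  have m: "mink (pt r u) (pt r u) = -1" by (simp add: mink_pt_pt)
  have "0 < pt r u $ 3"
  \<comment> \<open>On the lower sheet the negative of the point would lie in
    \<open>hyp_plane\<close>, so its product with \<open>c\<close> would be at most
    \<open>-1\<close>; but this product is \<open>cosh r\<close>.\<close>
  proof (rule ccontr)
    assume n: "\<not> 0 < pt r u $ 3"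
    have "(pt r u $ 3)\<^sup>2 \<noteq> 0"
      using m by (simp add: mink_def flip: power2_eq_square)
        (smt (verit) zero_le_power2 power_zero_numeral)
    with n have "0 < (- pt r u) $ 3" by simp
    then have "- pt r u \<in> hyp_plane" using m by (simp add: hyp_plane_def mink_def)
    from mink_hyp_plane(1)[OF center this] have "1 \<le> mink c (pt r u)"
      by (simp add: mink_def)
    then show False using mink_center_pt[of r u] cosh_real_pos[of r] by linarith
  qed
  with m show ?thesis by (simp add: hyp_plane_def)
qed

lemma hdist_center_pt: "0 \<le> r \<Longrightarrow> hdist c (pt r u) = r"
  by (simp add: hdist_def mink_center_pt arcosh_cosh_real)

lemma sinh_half_hdist_pt:
  "0 < r \<Longrightarrow> sinh (hdist (pt r u) (pt r w) / 2) = sinh r * \<bar>sin ((u - w) / 2)\<bar>"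
  by (rule sinh_half_hdist) (auto simp: pt_in_hyp_plane mink_pt_pt power_mult_distrib)

text \<open>Up to a factor depending only on \<open>r\<close>, this is the signed area of a
  Euclidean triangle inscribed in a circle. In the factored form, convexity can be read off from the
  order of the polar angles.\<close>

lemma det3_pt:
  "det3 (pt r u) (pt r v) (pt r w) =
     4 * cosh r * (sinh r)\<^sup>2 * sin ((v - u) / 2) * sin ((w - v) / 2) * sin ((w - u) / 2)"
proof -
  have lin: "det3 (p *\<^sub>R c + q *\<^sub>R (a1 *\<^sub>R f + b1 *\<^sub>R h)) (p *\<^sub>R c + q *\<^sub>R (a2 *\<^sub>R f + b2 *\<^sub>R h))
      (p *\<^sub>R c + q *\<^sub>R (a3 *\<^sub>R f + b3 *\<^sub>R h)) =
    p * q\<^sup>2 * (a1 * b2 - a2 * b1 + (a2 * b3 - a3 * b2) + (a3 * b1 - a1 * b3)) * det3 c f h"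
    for p q a1 a2 a3 b1 b2 b3
    unfolding det_3 vector_3 by (simp add: power2_eq_square) algebra
  have half: "sin x + sin y - sin (x + y) = 4 * sin (x / 2) * sin (y / 2) * sin ((x + y) / 2)"
    for x y :: real
  proof -
    define a where "a = x / 2"
    define b where "b = y / 2"
    have xy: "x = 2 * a" "y = 2 * b" by (simp_all add: a_def b_def)
    have "sin (2 * a) + sin (2 * b) - sin (2 * (a + b)) = 4 * sin a * sin b * sin (a + b)"
      unfolding sin_double sin_add cos_add using sin_cos_squared_add[of a] sin_cos_squared_add[of b]
      by algebra
    then show ?thesis by (simp add: xy add_divide_distrib distrib_left)
  qed
  have "det3 (pt r u) (pt r v) (pt r w) =
      cosh r * (sinh r)\<^sup>2 * (sin (v - u) + sin (w - v) - sin ((v - u) + (w - v)))"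
    unfolding pt_def lin oriented sin_diff by (simp add: sin_diff algebra_simps)
  then show ?thesis unfolding half by simp
qed

text \<open>The radius to the vertex splits the angle into base angles of the isosceles triangles
  over the two adjacent sides. As \<open>base\<close> is signed, one of these sides may separate the
  polygon from the center.\<close>

lemma hangle_pt:
  assumes r: "0 < r" and a: "0 < a" and b: "0 < b" and ab: "a + b < 2 * pi"
  shows "hangle (pt r (u - b)) (pt r u) (pt r (u + a)) = base a r + base b r"
proof -
  define p where "p = a / 2"
  define q where "q = b / 2"
  have pq: "a = 2 * p" "b = 2 * q" "0 < p" "0 < q" "p + q < pi"
    using assms by (auto simp: p_def q_def)
  have s: "0 < sin p" "0 < sin q" using pq by (auto intro!: sin_gt_zero)
  define S where "S = sinh r"
  have S: "0 < S" "(cosh r)\<^sup>2 = 1 + S\<^sup>2" using r by (simp_all add: S_def cosh_square_eq)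
  define x where "x = pt r u"
  define y where "y = pt r (u - b)"
  define z where "z = pt r (u + a)"
  have my: "mink x y = - 1 - 2 * (S * sin q)\<^sup>2" and mz: "mink x z = - 1 - 2 * (S * sin p)\<^sup>2"
    and mx: "mink x x = -1" "mink y y = -1" "mink z z = -1"
    by (simp_all add: x_def y_def z_def mink_pt_pt S_def q_def p_def power_mult_distrib)
  have "(u - b - (u + a)) / 2 = - (p + q)" by (simp add: pq field_simps)
  then have "sin ((u - b - (u + a)) / 2) = - sin (p + q)" by (simp only: sin_minus)
  then have myz: "mink y z = - 1 - 2 * (S * sin (p + q))\<^sup>2"
    unfolding y_def z_def mink_pt_pt S_def by (simp only: mult_minus_right power2_minus)
  define hp where "hp = sqrt (1 + S\<^sup>2 * (sin p)\<^sup>2)"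
  define hq where "hq = sqrt (1 + S\<^sup>2 * (sin q)\<^sup>2)"
  have hp: "0 < hp" "hp\<^sup>2 = 1 + S\<^sup>2 * (sin p)\<^sup>2" and hq: "0 < hq" "hq\<^sup>2 = 1 + S\<^sup>2 * (sin q)\<^sup>2"
    unfolding hp_def hq_def by (simp_all add: add_pos_nonneg)
  have tan: "mink (tangent_dir x v) (tangent_dir x w) = mink v w + mink x v * mink x w" for v w
    unfolding tangent_dir_def mink_simps mx by (simp add: mink_commute[of v x] mink_commute[of w x])
  have nrm: "sqrt (mink (tangent_dir x y) (tangent_dir x y)) = 2 * S * sin q * hq"
  proof (rule real_sqrt_unique)
    show "(2 * S * sin q * hq)\<^sup>2 = mink (tangent_dir x y) (tangent_dir x y)"
      unfolding tan mx my power_mult_distrib hq by (simp add: power2_eq_square algebra_simps)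
  qed (use S s hq in auto)
  have nrm': "sqrt (mink (tangent_dir x z) (tangent_dir x z)) = 2 * S * sin p * hp"
  proof (rule real_sqrt_unique)
    show "(2 * S * sin p * hp)\<^sup>2 = mink (tangent_dir x z) (tangent_dir x z)"
      unfolding tan mx mz power_mult_distrib hp by (simp add: power2_eq_square algebra_simps)
  qed (use S s hp in auto)
  have bp: "hp * sin (base a r) = cos p" "hp * cos (base a r) = cosh r * sin p"
    using base_sin_cos[of p r] pq by (auto simp: hp_def S_def)
  have bq: "hq * sin (base b r) = cos q" "hq * cos (base b r) = cosh r * sin q"
    using base_sin_cos[of q r] pq by (auto simp: hq_def S_def)
  have "hp * hq * cos (base a r + base b r) =
      (hp * cos (base a r)) * (hq * cos (base b r)) - (hp * sin (base a r)) * (hq * sin (base b r))"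
    by (simp add: cos_add algebra_simps)
  also have "\<dots> = (1 + S\<^sup>2) * sin p * sin q - cos p * cos q"
    unfolding bp bq S(2)[symmetric] by (simp add: power2_eq_square)
  finally have cosb: "hp * hq * cos (base a r + base b r) =
      (1 + S\<^sup>2) * sin p * sin q - cos p * cos q" .
  have "mink (tangent_dir x y) (tangent_dir x z) =
      4 * S\<^sup>2 * sin p * sin q * ((1 + S\<^sup>2) * sin p * sin q - cos p * cos q)"
    unfolding tan my mz myz sin_add power_mult_distrib
    using sin_cos_squared_add[of p] sin_cos_squared_add[of q] by algebra
  also have "\<dots> = (2 * S * sin q * hq) * (2 * S * sin p * hp) * cos (base a r + base b r)"
    unfolding cosb[symmetric] by (simp add: power2_eq_square algebra_simps)
  finally have "mink (tangent_dir x y) (tangent_dir x z) / ((2 * S * sin q * hq) * (2 * S * sin p * hp))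
      = cos (base a r + base b r)"
    using S s hp hq by simp
  then have "hangle y x z = arccos (cos (base a r + base b r))"
    by (simp add: hangle_def Let_def nrm nrm')
  \<comment> \<open>The condition \<open>a + b < 2 * pi\<close> makes the signed sum nonnegative, so
    that \<open>arccos\<close> undoes the cosine.\<close>
  moreover have "base (2 * pi - b) r < base a r"
    using base_strict_antimono[of a "2 * pi - b" r] assms by linarith
  then have "0 \<le> base a r + base b r" by (simp add: base_flip)
  moreover have "base a r < pi / 2" "base b r < pi / 2"
    using arctan_bounded by (auto simp: base_def)
  then have "base a r + base b r \<le> pi" by simp
  ultimately show ?thesis by (simp add: arccos_cos x_def y_def z_def)
qed

end

lemma frame_exists:
  assumes c: "c \<in> hyp_plane" and x: "x \<in> hyp_plane" and r: "0 < r" and cx: "mink c x = - cosh r"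
  obtains f h where "frame c f h" "x = frame.pt c f h r 0"
    "\<And>y. y \<in> hyp_plane \<Longrightarrow> mink c y = - cosh r \<Longrightarrow> \<exists>u. 0 \<le> u \<and> u < 2 * pi \<and> y = frame.pt c f h r u"
proof -
  have cc: "mink c c = -1" and xx: "mink x x = -1" using c x by (auto simp: hyp_plane_def)
  have s: "0 < sinh r" using r by simp
  \<comment> \<open>A unit tangent vector at \<open>c\<close> pointing to \<open>x\<close>, so that
    \<open>x\<close> gets the polar angle 0.\<close>
  define f where "f = (1 / sinh r) *\<^sub>R (x - cosh r *\<^sub>R c)"
  have cf: "mink c f = 0" by (simp add: f_def mink_simps cc cx)
  have "mink f f = ((cosh r)\<^sup>2 - 1) / (sinh r)\<^sup>2"
    by (simp add: f_def mink_simps cc cx xx mink_commute[of x c] power2_eq_square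
        flip: diff_divide_distrib)
  then have ff: "mink f f = 1" using s by (simp add: cosh_square_eq)
  \<comment> \<open>The Minkowski cross product of \<open>c\<close> and \<open>f\<close>: the
    timelike coordinate has the reversed sign, so that pairing with \<open>h\<close> is the
    determinant with first rows \<open>c\<close> and \<open>f\<close>.\<close>
  define h :: "real ^ 3" where
    "h = vector [c $ 2 * f $ 3 - c $ 3 * f $ 2, c $ 3 * f $ 1 - c $ 1 * f $ 3,
           c $ 2 * f $ 1 - c $ 1 * f $ 2]"
  have hz: "mink h z = det3 c f z" for z
    by (simp add: h_def mink_def det_3 algebra_simps)
  have hh: "mink h h = (mink c f)\<^sup>2 - mink c c * mink f f"
    by (simp add: h_def mink_def power2_eq_square algebra_simps)
  have hh: "mink h h = 1" using hh cc cf ff by simp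
  have ch: "mink c h = 0" "mink f h = 0"
    using hz[of c] hz[of f] by (auto simp: det3_same mink_commute[of h c] mink_commute[of h f])
  interpret fr: frame c f h
    using cc ff hh cf ch c hz[of h] by unfold_locales auto
  have xpt: "x = fr.pt r 0"
    unfolding fr.pt_def using s by (simp add: f_def)
  have "\<exists>u. 0 \<le> u \<and> u < 2 * pi \<and> y = fr.pt r u"
    if y: "y \<in> hyp_plane" and cy: "mink c y = - cosh r" for y
  proof -
    define p where "p = mink f y"
    define q where "q = mink h y"
    define z where "z = cosh r *\<^sub>R c + p *\<^sub>R f + q *\<^sub>R h"
    have comp: "mink c (y - z) = 0" "mink f (y - z) = 0" "mink h (y - z) = 0"
      by (simp_all add: z_def mink_simps fr.gram p_def q_def cy mink_commute[of f c]
          mink_commute[of h c] mink_commute[of h f])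
    \<comment> \<open>The remainder is orthogonal to the basis \<open>c\<close>, \<open>f\<close>,
      \<open>h\<close> with respect to \<open>mink\<close>, hence zero.\<close>
    define w where "w = y - z"
    have lin: "c $ 1 * w $ 1 + c $ 2 * w $ 2 = c $ 3 * w $ 3"
      "f $ 1 * w $ 1 + f $ 2 * w $ 2 = f $ 3 * w $ 3"
      "h $ 1 * w $ 1 + h $ 2 * w $ 2 = h $ 3 * w $ 3"
      using comp by (auto simp: mink_def w_def)
    have d: "det3 c f h = 1" by (rule fr.oriented)
    have "w $ 1 = 0" "w $ 2 = 0" "w $ 3 = 0"
      using lin d unfolding det_3 vector_3 by algebra+
    then have yz: "y = z" by (simp add: w_def vec3_eq_iff)
    have "mink z z = - (cosh r)\<^sup>2 + p\<^sup>2 + q\<^sup>2"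
      by (simp add: z_def mink_simps fr.gram mink_commute[of f c]
          mink_commute[of h c] mink_commute[of h f] power2_eq_square)
    moreover have "mink y y = -1" using y by (simp add: hyp_plane_def)
    ultimately have "p\<^sup>2 + q\<^sup>2 = (sinh r)\<^sup>2" using yz by (simp add: cosh_square_eq)
    then have "(p / sinh r)\<^sup>2 + (q / sinh r)\<^sup>2 = 1"
      using s by (simp add: power_divide flip: add_divide_distrib)
    then obtain u where u: "0 \<le> u" "u < 2 * pi" "p / sinh r = cos u" "q / sinh r = sin u"
      using sincos_total_2pi by blast
    then have "p = sinh r * cos u" "q = sinh r * sin u" using s by (auto simp: field_simps)
    then have "y = fr.pt r u" by (simp add: yz z_def fr.pt_def scaleR_add_right)
    with u show ?thesis by blast
  qed
  with that fr.frame_axioms xpt show ?thesis by blast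
qed

text \<open>The side \<open>d ! i\<close> is seen from the center under the angle \<open>a i\<close>, measured counterclockwise;
  so \<open>a i\<close> exceeds \<open>pi\<close> iff the side separates the polygon from its center.\<close>

definition central_angles :: "real list \<Rightarrow> real \<Rightarrow> (nat \<Rightarrow> real) \<Rightarrow> bool" where
  "central_angles d r a \<longleftrightarrow> 3 \<le> length d \<and> 0 < r \<and> (\<Sum>i<length d. a i) = 2 * pi \<and>
     (\<forall>i<length d. 0 < a i \<and> sinh (d ! i / 2) = sinh r * sin (a i / 2))"

section \<open>Correspondence between polygons and central angles\<close>

lemma sum_cyclic_pred:
  fixes f :: "nat \<Rightarrow> 'a::comm_monoid_add"
  assumes "0 < n"
  shows "(\<Sum>i<n. f ((i + n - 1) mod n)) = (\<Sum>i<n. f i)"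
proof -
  obtain m where n: "n = Suc m" using assms by (cases n) auto
  have "(\<Sum>i<Suc m. f ((i + Suc m - 1) mod Suc m)) = f m + (\<Sum>i<m. f ((Suc i + m) mod Suc m))"
    by (subst sum.lessThan_Suc_shift) simp
  also have "(\<Sum>i<m. f ((Suc i + m) mod Suc m)) = (\<Sum>i<m. f i)"
    by (intro sum.cong refl arg_cong[of _ _ f]) (metis add_Suc_shift lessThan_iff less_SucI mod_add_self2 mod_less)
  finally show ?thesis by (simp add: n add.commute)
qed

lemma two_angles_lt:
  fixes a :: "nat \<Rightarrow> real"
  assumes "3 \<le> n" "\<forall>i<n. 0 < a i" "(\<Sum>i<n. a i) = s" "i < n" "j < n" "i \<noteq> j"
  shows "a i + a j < s"
proof -
  have "card ({..<n} - {i, j}) = n - 2" using assms by (simp add: card_Diff_subset)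
  then have ne: "{..<n} - {i, j} \<noteq> {}" using assms(1) by (metis card.empty diff_is_0_eq not_less_eq_eq numeral_2_eq_2 numeral_3_eq_3)
  have "s = (\<Sum>k\<in>{i, j}. a k) + (\<Sum>k\<in>{..<n} - {i, j}. a k)"
    using assms by (subst assms(3)[symmetric], subst sum.subset_diff[of "{i, j}"]) auto
  moreover have "0 < (\<Sum>k\<in>{..<n} - {i, j}. a k)" using ne assms by (intro sum_pos) auto
  ultimately show ?thesis using assms by simp
qed

lemma one_angle_lt:
  fixes a :: "nat \<Rightarrow> real"
  assumes "3 \<le> n" "\<forall>i<n. 0 < a i" "(\<Sum>i<n. a i) = s" "i < n"
  shows "a i < s"
proof -
  define j :: nat where "j = (if i = 0 then 1 else 0)"
  have j: "j < n" "i \<noteq> j" using assms(1) by (auto simp: j_def)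
  have "0 < a j" using assms(2) j(1) by simp
  then show ?thesis using two_angles_lt[OF assms j] by linarith
qed

text \<open>With polar angles measured from the first vertex, convexity says that they increase
  along the list. The central angles are their differences, and each side contributes its base angle
  at both of its ends.\<close>

lemma polygon_central_angles:
  assumes conv: "convex_polygon xs" and circ: "circumscribed xs c r"
  obtains a where "central_angles (side_lengths xs) r a"
    "(\<Sum>i<length xs. interior_angle xs i) = 2 * (\<Sum>i<length xs. base (a i) r)"
proof -
  define n where "n = length xs"
  have n: "3 \<le> n" and hyp: "\<And>i. i < n \<Longrightarrow> xs ! i \<in> hyp_plane"
    and det: "\<And>i k. i < n \<Longrightarrow> k < n \<Longrightarrow> k \<noteq> i \<Longrightarrow> k \<noteq> Suc i mod n \<Longrightarrow>
        0 < det3 (xs ! i) (xs ! (Suc i mod n)) (xs ! k)"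
    using conv by (auto simp: convex_polygon_def n_def subset_iff)
  have c: "c \<in> hyp_plane" and r: "\<And>i. i < n \<Longrightarrow> hdist c (xs ! i) = r"
    using circ by (auto simp: circumscribed_def n_def)
  have ne: "xs ! 0 \<noteq> xs ! i" if "0 < i" "i < n" for i
  proof (cases "i = 1")
    case True
    then show ?thesis using det[of 0 2] n by (auto simp: det3_same)
  next
    case False
    then show ?thesis using det[of 0 i] n that by (auto simp: det3_same)
  qed
  have "0 \<le> r" using r[of 0] hdist_nonneg[OF c hyp[of 0]] n by auto
  moreover have mc: "mink c (xs ! i) = - cosh r" if "i < n" for i
    using cosh_hdist[OF c hyp[OF that]] r[OF that] by simp
  have "r \<noteq> 0"
  proof
    assume "r = 0"
    then have "mink c (xs ! 0) = -1" "mink c (xs ! 1) = -1" using mc n by auto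
    then have "c = xs ! 0" "c = xs ! 1" using mink_hyp_plane(2)[OF c] hyp n by auto
    then show False using ne[of 1] n by auto
  qed
  ultimately have rp: "0 < r" by simp
  have "mink c (xs ! 0) = - cosh r" "xs ! 0 \<in> hyp_plane" using mc hyp n by auto
  from frame_exists[OF c this(2) rp this(1)] obtain f h where fr: "frame c f h"
    and x0: "xs ! 0 = frame.pt c f h r 0"
    and ex: "\<And>y. y \<in> hyp_plane \<Longrightarrow> mink c y = - cosh r \<Longrightarrow>
      \<exists>u. 0 \<le> u \<and> u < 2 * pi \<and> y = frame.pt c f h r u" by blast
  interpret frame c f h by (rule fr)
  have "\<forall>i. \<exists>u. i < n \<longrightarrow> 0 \<le> u \<and> u < 2 * pi \<and> xs ! i = pt r u"
    using ex hyp mc by blast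
  then obtain u0 where u0: "\<And>i. i < n \<Longrightarrow> 0 \<le> u0 i \<and> u0 i < 2 * pi \<and> xs ! i = pt r (u0 i)"
    by metis
  \<comment> \<open>Index \<open>n\<close> stands for the first vertex after a full turn, so the
    last side needs no formula of its own.\<close>
  define u where "u i = (if i = 0 then 0 else if i = n then 2 * pi else u0 i)" for i
  have per: "pt r (v + 2 * pi) = pt r v" for v
    by (simp add: pt_def)
  have xu: "xs ! (i mod n) = pt r (u i)" if "i \<le> n" for i
    using that u0[of i] x0 per[of 0] n by (auto simp: u_def)
  have xu': "xs ! i = pt r (u i)" if "i < n" for i
    using xu[of i] that by simp
  have upos: "0 < u i \<and> u i < 2 * pi" if "0 < i" "i < n" for i
  proof -
    have "u i \<noteq> 0" using ne[OF that] xu'[OF that(2)] x0 by auto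
    then show ?thesis using u0[OF that(2)] that by (simp add: u_def)
  qed
  have mono: "u i < u (Suc i)" if i: "i < n" for i
  proof -
    consider "i = 0" | "Suc i = n" "i \<noteq> 0" | "0 < i" "Suc i < n" using i by linarith
    then show ?thesis
    proof cases
      case 1
      then show ?thesis using upos[of 1] n by (simp add: u_def)
    next
      case 2
      then show ?thesis using upos[of i] i by (simp add: u_def)
    next
      case 3
      \<comment> \<open>The first vertex lies to the left of the side from \<open>i\<close> to
        \<open>Suc i\<close>. Since half the polar angles of its ends lie strictly between 0 and
        \<open>pi\<close>, this fixes the sign of their difference.\<close>
      then have "0 < det3 (pt r (u i)) (pt r (u (Suc i))) (pt r (u 0))"
        using det[of i 0] xu'[of i] xu'[of "Suc i"] xu'[of 0] by auto
      moreover have "u 0 = 0" by (simp add: u_def)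
      ultimately have "0 < 4 * cosh r * (sinh r)\<^sup>2 * sin ((u (Suc i) - u i) / 2) *
          sin (- (u (Suc i) / 2)) * sin (- (u i / 2))"
        unfolding det3_pt by (simp only: diff_0 minus_divide_left)
      then have pos: "0 < 4 * cosh r * (sinh r)\<^sup>2 * (sin (u (Suc i) / 2) * sin (u i / 2)) *
          sin ((u (Suc i) - u i) / 2)"
        unfolding sin_minus by (simp only: minus_mult_minus mult_minus_left mult_minus_right mult_ac minus_minus)
      have "0 < sin (u (Suc i) / 2)" "0 < sin (u i / 2)"
        using upos[of i] upos[of "Suc i"] 3 by (auto intro!: sin_gt_zero)
      then have "0 < 4 * cosh r * (sinh r)\<^sup>2 * (sin (u (Suc i) / 2) * sin (u i / 2))"
        using rp by simp
      with pos have s: "0 < sin ((u (Suc i) - u i) / 2)" by (rule zero_less_mult_pos)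
      show ?thesis
      proof (rule ccontr)
        assume "\<not> ?thesis"
        then have "0 \<le> sin (- ((u (Suc i) - u i) / 2))"
        proof (intro sin_ge_zero)
          have "0 < u (Suc i)" "u i < 2 * pi" using upos[of i] upos[of "Suc i"] 3 by auto
          then have "u i - u (Suc i) \<le> 2 * pi" by linarith
          then show "- ((u (Suc i) - u i) / 2) \<le> pi" by (simp add: field_simps)
        qed (use \<open>\<not> u i < u (Suc i)\<close> in simp)
        with s show False unfolding sin_minus by linarith
      qed
    qed
  qed
  define a where "a i = u (Suc i) - u i" for i
  have sum: "(\<Sum>i<n. a i) = 2 * pi"
    unfolding a_def sum_lessThan_telescope using n by (simp add: u_def)
  have apos: "0 < a i" if "i < n" for i using mono[OF that] by (simp add: a_def)
  have alt: "a i + a j < 2 * pi" if "i < n" "j < n" "i \<noteq> j" for i j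
    using two_angles_lt[of n a "2 * pi" i j] n apos sum that by blast
  have alt': "a i < 2 * pi" if "i < n" for i
    using one_angle_lt[of n a "2 * pi" i] n apos sum that by blast
  have len: "length (side_lengths xs) = n" by (simp add: side_lengths_def n_def)
  have side: "sinh (side_lengths xs ! i / 2) = sinh r * sin (a i / 2)" if "i < n" for i
  proof -
    have "side_lengths xs ! i = hdist (pt r (u i)) (pt r (u (Suc i)))"
      using that xu[of "Suc i"] xu'[of i] by (simp add: side_lengths_def n_def)
    then have "sinh (side_lengths xs ! i / 2) = sinh r * \<bar>sin ((u i - u (Suc i)) / 2)\<bar>"
      using sinh_half_hdist_pt rp by simp
    also have "(u i - u (Suc i)) / 2 = - (a i / 2)" by (simp add: a_def field_simps)
    also have "\<bar>sin (- (a i / 2))\<bar> = sin (a i / 2)"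
      unfolding sin_minus using apos[OF that] alt'[OF that] sin_ge_zero[of "a i / 2"] by simp
    finally show ?thesis .
  qed
  have angle: "interior_angle xs i = base (a i) r + base (a ((i + n - 1) mod n)) r"
    if i: "i < n" for i
  proof -
    define p where "p = (i + n - 1) mod n"
    have p: "p < n" "p \<noteq> i" "xs ! p = pt r (u i - a p)"
    proof -
      show "p < n" using n by (simp add: p_def)
      show "p \<noteq> i" and "xs ! p = pt r (u i - a p)"
      proof -
        consider "i = 0" "p = n - 1" | "i \<noteq> 0" "p = i - 1"
        proof (cases "i = 0")
          case False
          then have "i + n - 1 = (i - 1) + n" by simp
          then have "p = i - 1" unfolding p_def using i by (simp only: mod_add_self2) simp
          with False that show ?thesis by blast
        qed (use n that in \<open>auto simp: p_def\<close>)
        then show "p \<noteq> i" "xs ! p = pt r (u i - a p)"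
        proof (atomize (full), cases)
          case 1
          then have "a p = 2 * pi - u p" using n by (simp add: a_def u_def)
          then show "p \<noteq> i \<and> xs ! p = pt r (u i - a p)"
            using 1 n xu'[of p] per[of "u p - 2 * pi"] by (simp add: u_def)
        next
          case 2
          then show "p \<noteq> i \<and> xs ! p = pt r (u i - a p)"
            using n i xu'[of p] by (simp add: a_def)
        qed
      qed
    qed
    have "xs ! (Suc i mod n) = pt r (u i + a i)" using xu[of "Suc i"] i by (simp add: a_def)
    moreover have "xs ! i = pt r (u i)" using xu' i by simp
    ultimately have "interior_angle xs i = hangle (pt r (u i - a p)) (pt r (u i)) (pt r (u i + a i))"
      unfolding interior_angle_def n_def[symmetric] p_def[symmetric] using p by simp
    also have "\<dots> = base (a i) r + base (a p) r"
      using rp apos[OF i] apos[OF p(1)] alt[of i p] i p by (intro hangle_pt) auto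
    finally show ?thesis by (simp add: p_def)
  qed
  have "(\<Sum>i<n. interior_angle xs i) = (\<Sum>i<n. base (a i) r) + (\<Sum>i<n. base (a ((i + n - 1) mod n)) r)"
    by (simp add: angle sum.distrib)
  also have "\<dots> = 2 * (\<Sum>i<n. base (a i) r)"
    using sum_cyclic_pred[of n "\<lambda>i. base (a i) r"] n by simp
  finally have "(\<Sum>i<length xs. interior_angle xs i) = 2 * (\<Sum>i<length xs. base (a i) r)"
    by (simp add: n_def)
  moreover have "central_angles (side_lengths xs) r a"
    unfolding central_angles_def len using n rp sum apos side by auto
  ultimately show ?thesis using that by blast
qed

lemma cyclic_polygon_exists:
  assumes d: "central_angles d r a"
  obtains xs where "cyclic_polygon xs" "side_lengths xs = d"
proof -
  define n where "n = length d"
  have n: "3 \<le> n" and r: "0 < r" and sum: "(\<Sum>i<n. a i) = 2 * pi"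
    and pos: "\<And>i. i < n \<Longrightarrow> 0 < a i"
    and side: "\<And>i. i < n \<Longrightarrow> sinh (d ! i / 2) = sinh r * sin (a i / 2)"
    using d by (auto simp: central_angles_def n_def)
  interpret frame "vector [0, 0, 1]" "vector [1, 0, 0]" "vector [0, 1, 0]"
    by unfold_locales (simp_all add: mink_def det_3 hyp_plane_def)
  define u where "u i = (\<Sum>l<i. a l)" for i
  have uS: "u (Suc i) = u i + a i" for i by (simp add: u_def)
  have mono: "u i < u k" if "i < k" "k \<le> n" for i k
    using that
  proof (induction k)
    case (Suc k)
    then show ?case using pos[of k] by (cases "i = k") (auto simp: uS)
  qed simp
  have un: "u n = 2 * pi" "u 0 = 0" by (simp_all add: u_def sum)
  have bnd: "0 \<le> u i" "u i \<le> 2 * pi" if "i \<le> n" for i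
    using mono[of 0 i] mono[of i n] un that by (cases "i = 0"; cases "i = n"; simp)+
  define xs where "xs = map (\<lambda>i. pt r (u i)) [0..<n]"
  have len: "length xs = n" by (simp add: xs_def)
  have nth: "xs ! i = pt r (u i)" if "i < n" for i using that by (simp add: xs_def)
  have nthS: "xs ! (Suc i mod n) = pt r (u (Suc i))" if "i < n" for i
  proof (cases "Suc i = n")
    case True
    then show ?thesis using nth[of 0] n un by (simp add: pt_def)
  next
    case False
    then show ?thesis using nth[of "Suc i"] that by simp
  qed
  have small: "a i < 2 * pi" if "i < n" for i
    using one_angle_lt[of n a "2 * pi" i] n pos sum that by blast
  have conv: "convex_polygon xs"
    unfolding convex_polygon_def len
  proof (intro conjI allI impI)
    show "set xs \<subseteq> hyp_plane" by (auto simp: xs_def pt_in_hyp_plane)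
    fix i k assume ik: "i < n" "k < n" "k \<noteq> i" "k \<noteq> Suc i mod n"
    have s: "0 < sin ((u (Suc i) - u i) / 2)"
      using pos[OF ik(1)] small[OF ik(1)] by (intro sin_gt_zero) (auto simp: uS)
    \<comment> \<open>The two sines have the same sign: both are negative if vertex \<open>k\<close>
      precedes the side, and both are positive if it follows.\<close>
    have "0 < sin ((u k - u (Suc i)) / 2) * sin ((u k - u i) / 2)"
    proof (cases "k < i")
      case True
      \<comment> \<open>Rules out \<open>Suc i = n\<close> together with \<open>k = 0\<close>, where
        the difference of the angles would be a full turn.\<close>
      have k0: "Suc i < n \<or> 0 < k" using ik by (cases "Suc i = n") auto
      have b: "u k < u i" "u i < u (Suc i)" using mono[of k i] mono[of i "Suc i"] True ik by auto
      have "u (Suc i) - u k < 2 * pi"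
        using k0 mono[of "Suc i" n] mono[of 0 k] un bnd[of k] bnd[of "Suc i"] ik by auto
      then have "u (Suc i) / 2 - u k / 2 < pi" "u i / 2 - u k / 2 < pi" using b by linarith+
      then have "0 < sin (- ((u k - u (Suc i)) / 2))" "0 < sin (- ((u k - u i) / 2))"
        using b by (auto intro!: sin_gt_zero simp: diff_divide_distrib)
      then show ?thesis unfolding sin_minus by (simp add: mult_neg_neg)
    next
      case False
      then have k: "Suc i < k" using ik by (cases "Suc i = n"; cases "k = Suc i") auto
      then have b: "u i < u (Suc i)" "u (Suc i) < u k" using mono ik by auto
      moreover have "u k < 2 * pi" "0 \<le> u i" using mono[of k n] un bnd ik by auto
      ultimately have "0 < sin ((u k - u (Suc i)) / 2)" "0 < sin ((u k - u i) / 2)"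
        by (auto intro!: sin_gt_zero)
      then show ?thesis by simp
    qed
    moreover have "0 < 4 * cosh r * (sinh r)\<^sup>2 * sin ((u (Suc i) - u i) / 2)"
      using s r by simp
    ultimately have "0 < 4 * cosh r * (sinh r)\<^sup>2 * sin ((u (Suc i) - u i) / 2) *
        (sin ((u k - u (Suc i)) / 2) * sin ((u k - u i) / 2))"
      by (simp only: mult_pos_pos)
    then show "0 < det3 (xs ! i) (xs ! (Suc i mod n)) (xs ! k)"
      unfolding nth[OF ik(1)] nth[OF ik(2)] nthS[OF ik(1)] det3_pt by (simp only: mult.assoc)
  qed (use n in simp)
  have "circumscribed xs (vector [0, 0, 1]) r"
    using r by (auto simp: circumscribed_def center xs_def hdist_center_pt)
  with conv have "cyclic_polygon xs" by (auto simp: cyclic_polygon_def)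
  moreover have "side_lengths xs = d"
  proof (rule nth_equalityI)
    show "length (side_lengths xs) = length d" by (simp add: side_lengths_def len n_def)
    fix i assume "i < length (side_lengths xs)"
    then have i: "i < n" by (simp add: side_lengths_def len)
    then have "side_lengths xs ! i = hdist (pt r (u i)) (pt r (u (Suc i)))"
      using nth[OF i] nthS[OF i] by (simp add: side_lengths_def len)
    then have "sinh (side_lengths xs ! i / 2) = sinh r * \<bar>sin ((u i - u (Suc i)) / 2)\<bar>"
      using sinh_half_hdist_pt r by simp
    also have "(u i - u (Suc i)) / 2 = - (a i / 2)" by (simp add: uS field_simps)
    also have "\<bar>sin (- (a i / 2))\<bar> = sin (a i / 2)"
      unfolding sin_minus using pos[OF i] small[OF i] sin_ge_zero[of "a i / 2"] by simp
    also have "sinh r * sin (a i / 2) = sinh (d ! i / 2)" using side[OF i] by simp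
    finally show "side_lengths xs ! i = d ! i" by simp
  qed
  ultimately show ?thesis using that by blast
qed


section \<open>Uniqueness of the radius and of the central angles\<close>

lemma central_angles_nonmax:
  assumes d: "central_angles d r a" and m: "m < length d" "\<forall>i<length d. d ! i \<le> d ! m"
    and i: "i < length d" "i \<noteq> m"
  shows "a i \<le> pi"
proof (rule ccontr)
  assume n: "\<not> a i \<le> pi"
  have lt: "a i + a m < 2 * pi"
    using two_angles_lt[of "length d" a "2 * pi" i m] d m i by (auto simp: central_angles_def)
  have am: "0 < a m" using d m by (auto simp: central_angles_def)
  \<comment> \<open>Both angles are acute, so the side \<open>d ! i\<close> would be longer than the
    longest side.\<close>
  have "sin (a m / 2) < sin (pi - a i / 2)"
    using lt n am by (intro sin_monotone_2pi) auto
  then have "sin (a m / 2) < sin (a i / 2)" by simp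
  then have "sinh r * sin (a m / 2) < sinh r * sin (a i / 2)"
    using d by (intro mult_strict_left_mono) (auto simp: central_angles_def)
  then have "sinh (d ! m / 2) < sinh (d ! i / 2)" using d m i by (simp add: central_angles_def)
  then have "d ! m < d ! i" by simp
  then show False using m(2) i(1) by (auto simp: not_less[symmetric])
qed

lemma central_angles_max_exists:
  assumes "central_angles d r a"
  obtains m where "m < length d" "\<forall>i<length d. d ! i \<le> d ! m"
proof -
  have "d \<noteq> []" using assms by (auto simp: central_angles_def)
  then obtain m where "m < length d" "d ! m = Max (set d)"
    by (metis List.finite_set Max_in in_set_conv_nth set_empty)
  then show ?thesis using that by simp
qed

text \<open>Suppose \<open>s > r\<close>. All sides except one longest side have half angles at most
  \<open>pi / 2\<close>, and these add up to \<open>pi\<close> minus the half angle of the longest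
  side, so the sum has the same sine as that half angle. The latter sine is scaled by exactly
  \<open>q\<close>, the former by more than \<open>q\<close>. No case distinction on the position of
  the center arises.\<close>

lemma central_angles_radius_le:
  assumes a: "central_angles d r a" and b: "central_angles d s b"
  shows "s \<le> r"
proof (rule ccontr)
  assume n: "\<not> s \<le> r"
  obtain m where m: "m < length d" "\<forall>i<length d. d ! i \<le> d ! m"
    using central_angles_max_exists[OF a] .
  have rs: "0 < r" "r < s" using a n by (auto simp: central_angles_def)
  define q where "q = sinh r / sinh s"
  have q: "0 < q" "q < 1" using rs by (auto simp: q_def)
  have scale: "sin (b i / 2) = q * sin (a i / 2)" if "i < length d" for i
    using a b that rs by (auto simp: central_angles_def q_def field_simps)
  define ds where "ds = filter (\<lambda>i. i \<noteq> m) [0..<length d]"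
  have sum: "sum_list (map (\<lambda>i. c i / 2) ds) = pi - c m / 2"
    if "(\<Sum>i<length d. c i) = 2 * pi" for c
  proof -
    have "sum_list (map (\<lambda>i. c i / 2) ds) = (\<Sum>i\<in>{..<length d} - {m}. c i / 2)"
      unfolding ds_def by (subst sum_list_distinct_conv_sum_set) (auto intro!: sum.cong)
    also have "\<dots> = (\<Sum>i<length d. c i / 2) - c m / 2"
      using m by (simp add: sum_diff1)
    finally show ?thesis using that by (simp flip: sum_divide_distrib)
  qed
  have "length ds = card ({..<length d} - {m})"
    unfolding ds_def by (subst distinct_card[symmetric]) (auto intro!: arg_cong[of _ _ card])
  moreover have "3 \<le> length d" using a by (simp add: central_angles_def)
  ultimately have len: "2 \<le> length ds" using m(1) by simp
  have "\<forall>i\<in>set ds. 0 < b i / 2 \<and> b i / 2 < a i / 2 \<and> a i / 2 \<le> pi / 2 \<and>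
      sin (b i / 2) = q * sin (a i / 2)"
  proof
    fix i assume "i \<in> set ds"
    then have i: "i < length d" "i \<noteq> m" by (auto simp: ds_def)
    have ab: "0 < a i" "a i \<le> pi" "0 < b i" "b i \<le> pi"
      using central_angles_nonmax[OF a m i] central_angles_nonmax[OF b m i] a b i
      by (auto simp: central_angles_def)
    have "0 < sin (a i / 2)" using ab by (intro sin_gt_zero) auto
    then have "sin (b i / 2) < sin (a i / 2)" using q scale[OF i(1)] by simp
    then have "b i / 2 < a i / 2"
      using ab sin_monotone_2pi_le[of "a i / 2" "b i / 2"] by (cases "b i < a i") auto
    then show "0 < b i / 2 \<and> b i / 2 < a i / 2 \<and> a i / 2 \<le> pi / 2 \<and>
      sin (b i / 2) = q * sin (a i / 2)" using ab scale[OF i(1)] by simp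
  qed
  moreover have sums: "(\<Sum>i<length d. a i) = 2 * pi" "(\<Sum>i<length d. b i) = 2 * pi"
    using a b by (auto simp: central_angles_def)
  moreover have "sum_list (map (\<lambda>i. a i / 2) ds) < pi"
    using sum[OF sums(1)] a m by (auto simp: central_angles_def)
  ultimately have "q * sin (pi - a m / 2) < sin (pi - b m / 2)"
    using sin_sum_list_scale[of ds "\<lambda>i. b i / 2" "\<lambda>i. a i / 2" q] q(1) len
    unfolding sum[OF sums(1)] sum[OF sums(2)] by blast
  then show False using scale[OF m(1)] by simp
qed

text \<open>All angles but that of a longest side are at most \<open>pi\<close> and so determined by
  their sines; the last one is determined by the total.\<close>

lemma central_angles_unique:
  assumes a: "central_angles d r a" and b: "central_angles d r b" and i: "i < length d"
  shows "a i = b i"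
proof -
  obtain m where m: "m < length d" "\<forall>i<length d. d ! i \<le> d ! m"
    using central_angles_max_exists[OF a] .
  have eq: "a i = b i" if i: "i < length d" "i \<noteq> m" for i
  proof -
    have ab: "0 < a i" "a i \<le> pi" "0 < b i" "b i \<le> pi"
      using central_angles_nonmax[OF a m i] central_angles_nonmax[OF b m i] a b i
      by (auto simp: central_angles_def)
    have "sinh r * sin (a i / 2) = sinh r * sin (b i / 2)" "0 < sinh r"
      using a b i by (auto simp: central_angles_def)
    then have "sin (a i / 2) = sin (b i / 2)" by simp
    then have "arcsin (sin (a i / 2)) = arcsin (sin (b i / 2))" by simp
    then show ?thesis using ab by (simp add: arcsin_sin)
  qed
  have "(\<Sum>i<length d. a i) = (\<Sum>i<length d. b i)" using a b by (simp add: central_angles_def)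
  moreover have "(\<Sum>i\<in>{..<length d} - {m}. a i) = (\<Sum>i\<in>{..<length d} - {m}. b i)"
    using eq by (intro sum.cong) auto
  ultimately have "a m = b m" using m by (simp add: sum.remove[of "{..<length d}" m])
  then show ?thesis using eq i by (cases "i = m") auto
qed

text \<open>Evaluates the choice in \<open>represented_polygon\<close> and the description in
  \<open>polygon_radius\<close>: every circumscribed circle of the chosen polygon yields central
  angles for \<open>d\<close>, hence has radius \<open>r\<close>.\<close>

lemma polygon_of_central_angles:
  assumes a: "central_angles d r a"
  shows "J d = r"
    and "(\<Sum>i<length d. interior_angle (represented_polygon d) i) = 2 * (\<Sum>i<length d. base (a i) r)"
proof -
  define xs where "xs = represented_polygon d"
  have "\<exists>xs. cyclic_polygon xs \<and> side_lengths xs = d"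
    using cyclic_polygon_exists[OF a] by blast
  from someI_ex[OF this] have xs: "cyclic_polygon xs" "side_lengths xs = d"
    unfolding xs_def represented_polygon_def by blast+
  then have conv: "convex_polygon xs" and ex: "\<exists>c s. circumscribed xs c s"
    by (auto simp: cyclic_polygon_def)
  have len: "length xs = length d" using xs(2) by (auto simp: side_lengths_def)
  have uniq: "s = r" if s: "circumscribed xs c s" for c s
  proof -
    obtain b where b: "central_angles d s b"
      using polygon_central_angles[OF conv s] xs by metis
    show ?thesis using central_angles_radius_le[OF a b] central_angles_radius_le[OF b a] by simp
  qed
  then obtain c where c: "circumscribed xs c r" using ex by blast
  show "J d = r"
    unfolding J_def polygon_radius_def xs_def[symmetric] by (rule the_equality) (use c uniq in blast)+
  obtain b where b: "central_angles d r b"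
    "(\<Sum>i<length xs. interior_angle xs i) = 2 * (\<Sum>i<length xs. base (b i) r)"
    using polygon_central_angles[OF conv c] xs by metis
  have "(\<Sum>i<length d. base (b i) r) = (\<Sum>i<length d. base (a i) r)"
    using central_angles_unique[OF a b(1)] by simp
  then show "(\<Sum>i<length d. interior_angle (represented_polygon d) i) = 2 * (\<Sum>i<length d. base (a i) r)"
    using b(2) len by (simp add: xs_def)
qed

section \<open>Angle sums of centered and non-centered polygons\<close>

definition angle_sum :: "real list \<Rightarrow> real" where
  "angle_sum d = (\<Sum>i<length d. interior_angle (represented_polygon d) i)"

definition bases :: "real list \<Rightarrow> real \<Rightarrow> real" where
  "bases ds r = (\<Sum>d\<leftarrow>ds. base (ang d r) r)"

lemma bases_simps [simp]:
  "bases [] r = 0" "bases (d # ds) r = base (ang d r) r + bases ds r"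
  "bases (ds @ es) r = bases ds r + bases es r"
  by (simp_all add: bases_def)

lemma sum_nth_eq: "(\<Sum>i<length ds. f (ds ! i)) = (\<Sum>d\<leftarrow>ds. f d)"
  by (simp add: sum_list_sum_nth atLeast0LessThan)

lemma centered_polygon:
  assumes "3 \<le> length ds" "\<forall>d\<in>set ds. 0 < d \<and> d / 2 \<le> r" "angs ds r = 2 * pi"
  shows "J ds = r" "angle_sum ds = 2 * bases ds r"
proof -
  have r: "0 < r" using assms by (cases ds) auto
  have pos: "0 < ds ! i" "ds ! i / 2 \<le> r" if "i < length ds" for i using assms that by auto
  have "(\<Sum>i<length ds. ang (ds ! i) r) = 2 * pi"
    unfolding sum_nth_eq[of "\<lambda>d. ang d r"] using assms(3) by (simp add: angs_def)
  then have c: "central_angles ds r (\<lambda>i. ang (ds ! i) r)"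
    unfolding central_angles_def using assms(1) r pos by (auto simp: ang_pos sinh_sin_ang)
  show "J ds = r" by (rule polygon_of_central_angles[OF c])
  have "(\<Sum>i<length ds. base (ang (ds ! i) r) r) = bases ds r"
    unfolding sum_nth_eq[of "\<lambda>d. base (ang d r) r"] by (simp add: bases_def)
  then show "angle_sum ds = 2 * bases ds r"
    unfolding angle_sum_def polygon_of_central_angles(2)[OF c] by simp
qed

lemma sum_nth_split:
  fixes f g :: "real \<Rightarrow> real"
  shows "(\<Sum>i<length (as @ x # bs). if i = length as then g x else f ((as @ x # bs) ! i)) =
    g x + (\<Sum>d\<leftarrow>as @ bs. f d)"
proof -
  define ds where "ds = as @ x # bs"
  have m: "length as < length ds" "ds ! length as = x" by (auto simp: ds_def)
  have "(\<Sum>i<length ds. if i = length as then g x else f (ds ! i)) =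
      g x + (\<Sum>i\<in>{..<length ds} - {length as}. f (ds ! i))"
    using m by (subst sum.remove[of _ "length as"]) auto
  also have "(\<Sum>i\<in>{..<length ds} - {length as}. f (ds ! i)) = (\<Sum>d\<leftarrow>ds. f d) - f x"
    unfolding sum_nth_eq[of f, symmetric] using m by (simp add: sum_diff1)
  also have "(\<Sum>d\<leftarrow>ds. f d) - f x = (\<Sum>d\<leftarrow>as @ bs. f d)" by (simp add: ds_def)
  finally show ?thesis unfolding ds_def .
qed

lemma noncentered_polygon:
  assumes len: "3 \<le> length (as @ x # bs)" and x: "0 < x" "x / 2 \<le> r"
    and pos: "\<forall>d\<in>set (as @ bs). 0 < d \<and> d \<le> x" and eq: "angs (as @ bs) r = ang x r"
  shows "J (as @ x # bs) = r"
    "angle_sum (as @ x # bs) = 2 * (bases (as @ bs) r - base (ang x r) r)"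
proof -
  define ds where "ds = as @ x # bs"
  \<comment> \<open>The center lies on or beyond the side \<open>x\<close>, which therefore subtends
    the rest of the full turn. By \<open>base_flip\<close> its base angle changes sign.\<close>
  define a where "a i = (if i = length as then 2 * pi - ang x r else ang (ds ! i) r)" for i
  have r: "0 < r" using x by linarith
  have nth: "0 < ds ! i" "ds ! i / 2 \<le> r" if "i < length ds" for i
  proof -
    have "ds ! i \<in> set ds" using that by simp
    then have "0 < ds ! i \<and> ds ! i \<le> x" using pos x unfolding ds_def by auto
    then show "0 < ds ! i" "ds ! i / 2 \<le> r" using x by auto
  qed
  have "(\<Sum>i<length ds. a i) = 2 * pi"
    unfolding a_def ds_def using eq
    by (subst sum_nth_split[where f = "\<lambda>d. ang d r" and g = "\<lambda>x. 2 * pi - ang x r"])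
      (simp add: angs_def)
  moreover have "0 < a i \<and> sinh (ds ! i / 2) = sinh r * sin (a i / 2)" if "i < length ds" for i
  proof (cases "i = length as")
    case True
    have "sin (pi - ang x r / 2) = sin (ang x r / 2)" by simp
    then have "sin ((2 * pi - ang x r) / 2) = sin (ang x r / 2)" by (simp add: diff_divide_distrib)
    then show ?thesis
      using True order.strict_trans1[OF ang_le_pi[OF x(1) r], of "2 * pi"] sinh_sin_ang[OF x]
      by (simp add: a_def ds_def)
  next
    case False
    then show ?thesis using nth[OF that] r by (simp add: a_def ang_pos sinh_sin_ang)
  qed
  ultimately have c: "central_angles ds r a"
    unfolding central_angles_def using len r by (simp add: ds_def)
  show "J (as @ x # bs) = r" using polygon_of_central_angles(1)[OF c] by (simp add: ds_def)
  have "(\<Sum>i<length ds. base (a i) r) =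
      (\<Sum>i<length ds. if i = length as then - base (ang x r) r else base (ang (ds ! i) r) r)"
    by (intro sum.cong) (auto simp: a_def base_flip)
  also have "\<dots> = bases (as @ bs) r - base (ang x r) r"
    unfolding ds_def
    by (subst sum_nth_split[where f = "\<lambda>d. base (ang d r) r" and g = "\<lambda>x. - base (ang x r) r"])
      (simp add: bases_def)
  finally show "angle_sum (as @ x # bs) = 2 * (bases (as @ bs) r - base (ang x r) r)"
    using polygon_of_central_angles(2)[OF c] by (simp add: angle_sum_def ds_def)
qed

lemma D_polygon_angle_sum: "D_polygon R d = (real (length d) - 2) * pi - cosh R * angle_sum d"
  by (simp add: D_polygon_def angle_sum_def)

section \<open>Variation of the angle sum\<close>

text \<open>Right triangle with hypotenuse \<open>r\<close> and leg \<open>d / 2\<close>. This form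
  has the fixed side as a parameter and avoids the dependence of the apex angle on
  \<open>r\<close>.\<close>

lemma base_ang:
  assumes "0 < d" "d / 2 \<le> r"
  shows "base (ang d r) r = arccos (tanh (d / 2) / tanh r)"
proof -
  define p where "p = ang d r / 2"
  have r: "0 < r" using assms by linarith
  have p: "0 < p" "p \<le> pi / 2" using ang_pos[of d r] ang_le_pi[of d r] assms r by (auto simp: p_def)
  have p': "p < pi" using p pi_gt_zero by linarith
  have s: "sinh r * sin p = sinh (d / 2)" unfolding p_def by (rule sinh_sin_ang[OF assms])
  have "sqrt (1 + (sinh r)\<^sup>2 * (sin p)\<^sup>2) = cosh (d / 2)"
    unfolding power_mult_distrib[symmetric] s
    by (rule real_sqrt_unique) (auto simp: cosh_square_eq)
  with base_sin_cos(2)[OF p(1) p', of r]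
  have "cosh (d / 2) * cos (base (2 * p) r) = cosh r * sin p" by simp
  also have "sin p = sinh (d / 2) / sinh r" using s r by (auto simp: field_simps)
  finally have "cosh (d / 2) * cos (base (2 * p) r) = cosh r * (sinh (d / 2) / sinh r)" .
  moreover have "0 < cosh (d / 2)" by simp
  ultimately have "cos (base (2 * p) r) = cosh r * (sinh (d / 2) / sinh r) / cosh (d / 2)"
    by (metis nonzero_mult_div_cancel_left less_irrefl)
  then have "cos (base (2 * p) r) = tanh (d / 2) / tanh r"
    using r by (simp add: tanh_def divide_simps mult_ac)
  moreover have "0 \<le> cot p" using p by (auto simp: cot_def intro!: divide_nonneg_nonneg sin_ge_zero cos_ge_zero)
  then have "0 \<le> base (2 * p) r" by (simp add: base_def)
  moreover have "base (2 * p) r \<le> pi"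
    unfolding base_def using arctan_ubound pi_gt_zero by (smt (verit) field_sum_of_halves)
  ultimately have "arccos (tanh (d / 2) / tanh r) = base (2 * p) r"
    by (metis arccos_cos)
  then show ?thesis by (simp add: p_def)
qed

definition pot :: "real \<Rightarrow> real \<Rightarrow> real" where
  "pot d r = 2 * base (ang d r) r + ang d r / cosh r"

lemma pot_alt:
  assumes "0 < d" "d / 2 \<le> r"
  shows "pot d r = 2 * arccos (tanh (d / 2) / tanh r) + 2 * arcsin (sinh (d / 2) / sinh r) / cosh r"
  using ang_ratio[OF assms] by (simp add: pot_def base_ang[OF assms]) (simp add: ang_def min_absorb2)

lemma tanh_ratio:
  fixes d r :: real
  assumes "0 < d" "d / 2 \<le> r"
  shows "0 < tanh (d / 2) / tanh r" "tanh (d / 2) / tanh r \<le> 1"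
  using assms by (auto simp: divide_simps)

text \<open>The radius \<open>d / 2\<close> does occur, when the center is the midpoint of a side.
  \<open>pot_deriv\<close> says nothing there, and the mean value theorem needs continuity up to
  this endpoint.\<close>

lemma continuous_on_pot:
  assumes "0 < d"
  shows "continuous_on {d / 2..} (pot d)"
proof -
  have "continuous_on {d / 2..}
     (\<lambda>r. 2 * arccos (tanh (d / 2) / tanh r) + 2 * arcsin (sinh (d / 2) / sinh r) / cosh r)"
  proof (intro continuous_intros ballI conjI)
    fix r assume "r \<in> {d / 2..}"
    then have r: "d / 2 \<le> r" by simp
    show "- 1 \<le> tanh (d / 2) / tanh r" "tanh (d / 2) / tanh r \<le> 1"
      "- 1 \<le> sinh (d / 2) / sinh r" "sinh (d / 2) / sinh r \<le> 1"
      using tanh_ratio[OF assms r] ang_ratio[OF assms r] by linarith+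
  qed (use assms in auto)
  then show ?thesis
    by (rule continuous_on_eq) (use assms in \<open>simp add: pot_alt\<close>)
qed

text \<open>At fixed \<open>d\<close> twice the base angle and \<open>ang d r / cosh r\<close> have opposite derivatives, except
  for the contribution of the weight \<open>1 / cosh r\<close>.\<close>

lemma pot_deriv:
  assumes "0 < d" "d / 2 < r"
  shows "(pot d has_real_derivative - (sinh r / (cosh r)\<^sup>2) * ang d r) (at r)"
proof -
  define s where "s = sinh (d / 2)"
  define t where "t = tanh (d / 2)"
  define ch where "ch = cosh (d / 2)"
  define S where "S = sinh r"
  define Ch where "Ch = cosh r"
  have r: "0 < r" using assms by linarith
  have pos: "0 < s" "0 < t" "0 < ch" "0 < S" "0 < Ch"
    using assms r by (auto simp: s_def t_def ch_def S_def Ch_def)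
  have sS: "s < S" using assms by (simp add: s_def S_def)
  have ts: "t = s / ch" "tanh r = S / Ch" by (auto simp: s_def t_def ch_def S_def Ch_def tanh_def)
  have sq: "ch\<^sup>2 = 1 + s\<^sup>2" "Ch\<^sup>2 = 1 + S\<^sup>2"
    by (auto simp: s_def ch_def S_def Ch_def cosh_square_eq)
  define w where "w = sqrt (1 - (s / S)\<^sup>2)"
  have "s\<^sup>2 < S\<^sup>2" using pos sS by (intro power_strict_mono) auto
  then have "(s / S)\<^sup>2 < 1" using pos by (simp add: power_divide)
  then have w: "0 < w" "w\<^sup>2 = 1 - (s / S)\<^sup>2" by (auto simp: w_def)
  have tt: "t / tanh r = s * Ch / (ch * S)" by (simp add: ts)
  \<comment> \<open>Up to the factor \<open>ch\<close> the two square roots agree. Hence the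
    derivatives of the arccosine and of the arcsine cancel, and only that of the weight
    \<open>1 / cosh r\<close> survives.\<close>
  have wt: "sqrt (1 - (t / tanh r)\<^sup>2) = w / ch"
  proof (rule real_sqrt_unique)
    have "(w / ch)\<^sup>2 = (S\<^sup>2 - s\<^sup>2) / (ch\<^sup>2 * S\<^sup>2)"
      using pos by (simp add: power_divide w divide_simps)
    also have "S\<^sup>2 - s\<^sup>2 = ch\<^sup>2 * S\<^sup>2 - s\<^sup>2 * Ch\<^sup>2" unfolding sq by (simp add: algebra_simps)
    also have "\<dots> / (ch\<^sup>2 * S\<^sup>2) = 1 - (t / tanh r)\<^sup>2"
      unfolding tt using pos by (simp add: power_divide power_mult_distrib diff_divide_distrib)
    finally show "(w / ch)\<^sup>2 = 1 - (t / tanh r)\<^sup>2" .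
  qed (use w pos in simp)
  have lt: "t / tanh r < 1" "0 < t / tanh r"
    using assms r by (auto simp: t_def divide_simps)
  have lt': "s / S < 1" "0 < s / S" using sS pos by auto
  have d1: "((\<lambda>r. t / tanh r) has_real_derivative - t / S\<^sup>2) (at r)"
  proof -
    have "((\<lambda>r. t / tanh r) has_real_derivative - (t * (1 - (tanh r)\<^sup>2)) / (tanh r)\<^sup>2) (at r)"
      using r by (auto intro!: derivative_eq_intros simp: power2_eq_square)
    also have "- (t * (1 - (tanh r)\<^sup>2)) / (tanh r)\<^sup>2 = - t * (Ch\<^sup>2 - S\<^sup>2) / S\<^sup>2"
      unfolding ts using pos by (simp add: power_divide divide_simps)
    also have "\<dots> = - t / S\<^sup>2" by (simp add: sq)
    finally show ?thesis .
  qed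
  have d2: "((\<lambda>r. s / sinh r) has_real_derivative - s * Ch / S\<^sup>2) (at r)"
    using r by (auto intro!: derivative_eq_intros simp: power2_eq_square S_def Ch_def)
  have D1: "((\<lambda>r. arccos (t / tanh r)) has_real_derivative inverse (- sqrt (1 - (t / tanh r)\<^sup>2)) * (- t / S\<^sup>2)) (at r)"
    by (rule DERIV_chain2[OF DERIV_arccos d1]) (use lt in auto)
  have D2: "((\<lambda>r. arcsin (s / sinh r)) has_real_derivative inverse (sqrt (1 - (s / sinh r)\<^sup>2)) * (- s * Ch / S\<^sup>2)) (at r)"
    by (rule DERIV_chain2[OF DERIV_arcsin d2]) (use lt' S_def in auto)
  have DC: "(cosh has_real_derivative sinh r) (at r)"
    by (auto intro!: derivative_eq_intros)
  have "((\<lambda>r. 2 * arccos (t / tanh r) + 2 * arcsin (s / sinh r) / cosh r) has_real_derivative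
      2 * (inverse (- sqrt (1 - (t / tanh r)\<^sup>2)) * (- t / S\<^sup>2)) +
      (2 * (inverse (sqrt (1 - (s / sinh r)\<^sup>2)) * (- s * Ch / S\<^sup>2)) * cosh r
        - 2 * arcsin (s / sinh r) * sinh r) / (cosh r * cosh r)) (at r)"
    by (rule DERIV_add[OF DERIV_cmult[OF D1] DERIV_divide[OF DERIV_cmult[OF D2] DC]]) simp
  also have "2 * (inverse (- sqrt (1 - (t / tanh r)\<^sup>2)) * (- t / S\<^sup>2)) +
      (2 * (inverse (sqrt (1 - (s / sinh r)\<^sup>2)) * (- s * Ch / S\<^sup>2)) * cosh r
        - 2 * arcsin (s / sinh r) * sinh r) / (cosh r * cosh r) = - (S / Ch\<^sup>2) * (2 * arcsin (s / S))"
    unfolding wt w_def[symmetric] S_def[symmetric] Ch_def[symmetric]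
    unfolding ts(1) using pos w(1) by (simp add: field_simps power2_eq_square)
  also have "2 * arcsin (s / S) = ang d r"
    using lt' by (simp add: ang_def s_def[symmetric] S_def[symmetric] min_absorb2)
  finally have "((\<lambda>r. 2 * arccos (t / tanh r) + 2 * arcsin (s / sinh r) / cosh r)
      has_real_derivative - (sinh r / (cosh r)\<^sup>2) * ang d r) (at r)"
    by (simp add: S_def Ch_def)
  then show ?thesis
    by (rule has_field_derivative_transform_within_open[of _ _ _ "{d / 2<..}"])
      (use assms in \<open>auto simp: pot_alt s_def t_def\<close>)
qed

definition pots :: "real list \<Rightarrow> real \<Rightarrow> real" where
  "pots ds r = (\<Sum>d\<leftarrow>ds. pot d r)"

lemma pots_simps [simp]:
  "pots [] r = 0" "pots (d # ds) r = pot d r + pots ds r" "pots (ds @ es) r = pots ds r + pots es r"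
  by (simp_all add: pots_def)

lemma pots_eq: "pots ds r = 2 * bases ds r + angs ds r / cosh r"
  by (induction ds) (auto simp: pot_def add_divide_distrib)

lemma continuous_on_pots:
  "\<forall>d\<in>set ds. 0 < d \<and> d / 2 \<le> r \<Longrightarrow> continuous_on {r..} (pots ds)"
  by (induction ds)
    (auto simp: pots_def [abs_def] intro!: continuous_intros continuous_on_subset[OF continuous_on_pot])

lemma pots_deriv:
  "\<forall>d\<in>set ds. 0 < d \<and> d / 2 < r \<Longrightarrow>
    (pots ds has_real_derivative - (sinh r / (cosh r)\<^sup>2) * angs ds r) (at r)"
proof (induction ds)
  case Nil
  then show ?case by (simp add: pots_def [abs_def])
next
  case (Cons d ds)
  then have "((\<lambda>r. pot d r + pots ds r) has_real_derivative
     - (sinh r / (cosh r)\<^sup>2) * ang d r + - (sinh r / (cosh r)\<^sup>2) * angs ds r) (at r)"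
    by (intro DERIV_add pot_deriv) auto
  moreover have "pots (d # ds) = (\<lambda>r. pot d r + pots ds r)" by auto
  ultimately show ?case by (simp only: angs_Cons distrib_left)
qed

text \<open>The derivative is a negative factor times the excess of \<open>angs ps - angs ns\<close>
  over \<open>c\<close>. In the applications \<open>c\<close> is the value prescribed by the angle
  condition, \<open>2 * pi\<close> at the root and \<open>0\<close> at the initial vertex, or
  \<open>ps\<close> and \<open>ns\<close> are two lengths of the tree edge.\<close>

lemma pots_decreasing:
  assumes "0 < r" "r \<le> s" and d: "\<forall>d\<in>set (ps @ ns). 0 < d \<and> d / 2 \<le> r"
    and c: "\<And>q. r < q \<Longrightarrow> q < s \<Longrightarrow> c \<le> angs ps q - angs ns q"
  shows "pots ps s - pots ns s - c / cosh s \<le> pots ps r - pots ns r - c / cosh r"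
proof (cases "r = s")
  case False
  then have rs: "r < s" using assms by simp
  define F where "F q = pots ps q - pots ns q - c / cosh q" for q
  have D: "(F has_real_derivative - (sinh q / (cosh q)\<^sup>2) * (angs ps q - angs ns q - c)) (at q)"
    if "r < q" for q
  proof -
    have "((\<lambda>q. c / cosh q) has_real_derivative - (c * sinh q) / (cosh q)\<^sup>2) (at q)"
      by (auto intro!: derivative_eq_intros simp: power2_eq_square)
    moreover have "\<forall>d\<in>set (ps @ ns). 0 < d \<and> d / 2 < q"
      using d that by (meson order.strict_trans1)
    then have "\<forall>d\<in>set ps. 0 < d \<and> d / 2 < q" "\<forall>d\<in>set ns. 0 < d \<and> d / 2 < q"
      by simp_all
    ultimately have "(F has_real_derivative - (sinh q / (cosh q)\<^sup>2) * angs ps q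
        - - (sinh q / (cosh q)\<^sup>2) * angs ns q - - (c * sinh q) / (cosh q)\<^sup>2) (at q)"
      unfolding F_def [abs_def] by (intro DERIV_diff pots_deriv)
    then show ?thesis by (simp add: algebra_simps diff_divide_distrib add_divide_distrib)
  qed
  have cont: "continuous_on {r..s} F"
    unfolding F_def [abs_def]
    by (intro continuous_intros continuous_on_subset[OF continuous_on_pots[of ps r]]
        continuous_on_subset[OF continuous_on_pots[of ns r]]) (use d in auto)
  have dif: "F differentiable (at q)" if "r < q" "q < s" for q
    using D[OF that(1)] by (auto simp: real_differentiable_def)
  obtain l z where z: "r < z" "z < s" "(F has_real_derivative l) (at z)" "F s - F r = (s - r) * l"
    using MVT[OF rs cont dif] by blast
  have "l = - (sinh z / (cosh z)\<^sup>2) * (angs ps z - angs ns z - c)"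
    by (rule DERIV_unique[OF z(3) D[OF z(1)]])
  moreover have "0 \<le> sinh z / (cosh z)\<^sup>2 * (angs ps z - angs ns z - c)"
    using c[OF z(1,2)] z(1) \<open>0 < r\<close> by (intro mult_nonneg_nonneg) auto
  ultimately have "l \<le> 0" by simp
  then have "F s \<le> F r" using z(4) rs mult_nonneg_nonpos[of "s - r" l] by simp
  then show ?thesis by (simp add: F_def)
qed simp

lemma pots_increasing:
  assumes "0 < r" "r \<le> s" and "\<forall>d\<in>set (ps @ ns). 0 < d \<and> d / 2 \<le> r"
    and "\<And>q. r < q \<Longrightarrow> q < s \<Longrightarrow> angs ps q - angs ns q \<le> c"
  shows "pots ps r - pots ns r - c / cosh r \<le> pots ps s - pots ns s - c / cosh s"
proof -
  have "pots ns s - pots ps s - (- c) / cosh s \<le> pots ns r - pots ps r - (- c) / cosh r"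
    by (rule pots_decreasing) (use assms in \<open>auto simp: algebra_simps\<close>)
  then show ?thesis by simp
qed

section \<open>Two polygons sharing a side\<close>

lemma angs_IVT:
  assumes ds: "\<forall>d\<in>set ds. 0 < d" and r: "0 < r" and t: "0 < t" "t \<le> angs ds r"
  obtains s where "r \<le> s" "angs ds s = t"
proof -
  have "\<forall>\<^sub>F s in at_top. angs ds s < t"
    using tendsto_angs_0[OF ds] t(1) by (rule order_tendstoD)
  then have "\<forall>\<^sub>F s in at_top. angs ds s < t \<and> r \<le> s"
    using eventually_ge_at_top by (rule eventually_conj)
  then obtain s where s: "angs ds s < t" "r \<le> s"
    using eventually_happens by (metis (no_types, lifting) trivial_limit_at_top_linorder)
  have "\<exists>q. r \<le> q \<and> q \<le> s \<and> angs ds q = t"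
    by (rule IVT2') (use s t r in \<open>auto intro!: continuous_on_subset[OF continuous_on_angs[OF ds]]\<close>)
  then show ?thesis using that by blast
qed

text \<open>The two polygons sharing the edge of length \<open>x\<close>: the remaining sides are \<open>as\<close>
  at the initial vertex and \<open>bs\<close> at the root.\<close>

locale one_edge =
  fixes as bs :: "real list"
  assumes as: "\<forall>a\<in>set as. 0 < a" "2 \<le> length as"
    and bs: "\<forall>b\<in>set bs. 0 < b" "2 \<le> length bs"
begin

text \<open>\<open>j\<close> is the radius of the centered polygon with sides \<open>x\<close> and \<open>bs\<close>, and
  \<open>k\<close> that of the non-centered polygon with longest side \<open>x\<close> and further sides \<open>as\<close>.\<close>

definition radii :: "real \<Rightarrow> real \<Rightarrow> real \<Rightarrow> bool" where
  "radii x j k \<longleftrightarrow> 0 < x \<and> x / 2 \<le> j \<and> (\<forall>b\<in>set bs. b / 2 \<le> j) \<and> angs bs j + ang x j = 2 * pi \<and>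
     x / 2 \<le> k \<and> (\<forall>a\<in>set as. a \<le> x) \<and> angs as k = ang x k \<and> angs as (x / 2) \<le> pi"

text \<open>\<open>pot x k\<close> is subtracted because at the initial vertex the center lies on or
  beyond the tree edge. The angle condition there has the value 0, so it adds no constant over
  \<open>cosh k\<close>.\<close>

definition total :: "real \<Rightarrow> real \<Rightarrow> real \<Rightarrow> real" where
  "total x j k = (pots bs j + pot x j - 2 * pi / cosh j) + (pots as k - pot x k)"

lemma total_eq:
  "radii x j k \<Longrightarrow>
    total x j k = 2 * (bases bs j + base (ang x j) j) + 2 * (bases as k - base (ang x k) k)"
proof -
  assume r: "radii x j k"
  have "total x j k = 2 * (bases bs j + base (ang x j) j) + 2 * (bases as k - base (ang x k) k)
      + (angs bs j + ang x j - 2 * pi) / cosh j + (angs as k - ang x k) / cosh k"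
    by (simp add: total_def pots_eq pot_def algebra_simps add_divide_distrib diff_divide_distrib)
  then show ?thesis using r by (simp add: radii_def)
qed

lemma radii_pos: "radii x j k \<Longrightarrow> 0 < x \<and> 0 < j \<and> 0 < k"
  unfolding radii_def by linarith

lemma radii_as: "radii x j k \<Longrightarrow> a \<in> set as \<Longrightarrow> 0 < a \<and> a / 2 \<le> k"
  unfolding radii_def using as by (auto intro: order_trans[of "a / 2" "x / 2"])

lemma radii_crossing:
  assumes "radii x j k" "k < r"
  shows "ang x r < angs as r"
proof (rule angs_crossing)
  show "\<forall>d\<in>set as. 0 < d \<and> d / 2 \<le> k" using radii_as[OF assms(1)] by blast
  show "angs as k \<le> pi" using assms(1) radii_pos[OF assms(1)] ang_le_pi[of x k] by (simp add: radii_def)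
qed (use assms as in \<open>auto simp: radii_def\<close>)

lemma radii_le:
  assumes "radii x j k" "radii x j' k'"
  shows "j \<le> j'"
proof (rule ccontr)
  assume "\<not> j \<le> j'"
  moreover have "\<forall>d\<in>set (x # bs). 0 < d \<and> d / 2 \<le> j'"
    using assms(2) bs by (auto simp: radii_def)
  ultimately have "angs (x # bs) j < angs (x # bs) j'"
    using radii_pos[OF assms(2)] by (intro angs_strict_antimono) auto
  then show False using assms by (simp add: radii_def)
qed

lemma radii_unique:
  assumes "radii x j k" "radii x j' k'"
  shows "j = j'" "k = k'"
proof -
  show "j = j'" using radii_le[OF assms] radii_le[OF assms(2,1)] by simp
  show "k = k'"
    using radii_crossing[OF assms(1), of k'] radii_crossing[OF assms(2), of k] assms
    by (cases k k' rule: linorder_cases) (auto simp: radii_def)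
qed

text \<open>Beyond \<open>k'\<close> the sides \<open>as\<close> subtend more than
  \<open>x'\<close>, hence more than \<open>x\<close>, whereas at radius \<open>k\<close> they
  subtend the same as \<open>x\<close>.\<close>

lemma radius_mono:
  assumes 1: "radii x j k" and 2: "radii x' j' k'" and x: "x < x'"
  shows "k \<le> k'"
proof (rule ccontr)
  assume "\<not> k \<le> k'"
  then have k: "k' < k" by simp
  have "ang x' k < angs as k" by (rule radii_crossing[OF 2 k])
  moreover have "ang x k \<le> ang x' k" using radii_pos[OF 1] x by (intro ang_mono) auto
  ultimately show False using 1 by (simp add: radii_def)
qed

text \<open>As a function of \<open>j\<close>, \<open>total x j k\<close> is minimal at the actual radius, and as a function of \<open>k\<close>
  it is maximal there. This permits replacing \<open>j'\<close> by \<open>j\<close> and \<open>k\<close> by \<open>k'\<close>, without knowing how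
  the radii depend on \<open>x\<close>.\<close>

lemma total_step:
  assumes 1: "radii x j k" and 2: "radii x' j' k'" and x: "x < x'" and le: "k' \<le> j"
  shows "total x' j' k' \<le> total x j k"
proof -
  note pos = radii_pos[OF 1] radii_pos[OF 2]
  have kk: "k \<le> k'" by (rule radius_mono[OF 1 2 x])
  have eqj: "angs (x' # bs) j' = 2 * pi" using 2 by (simp add: radii_def)
  have x': "x' / 2 \<le> k'" "x' / 2 \<le> j'" using 2 by (auto simp: radii_def)
  have "pots (x' # bs) j' - pots [] j' - 2 * pi / cosh j' \<le> pots (x' # bs) j - pots [] j - 2 * pi / cosh j"
  proof (cases "j \<le> j'")
    case True
    show ?thesis
    proof (rule pots_decreasing)
      fix q assume q: "j < q" "q < j'"
      have "angs (x' # bs) j' \<le> angs (x' # bs) q"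
        using q pos bs by (intro angs_antimono) auto
      then show "2 * pi \<le> angs (x' # bs) q - angs [] q" using eqj by simp
    qed (use pos True x' le 1 bs in \<open>auto simp: radii_def\<close>)
  next
    case False
    show ?thesis
    proof (rule pots_increasing)
      fix q assume q: "j' < q" "q < j"
      have "angs (x' # bs) q \<le> angs (x' # bs) j'"
        using q pos bs by (intro angs_antimono) auto
      then show "angs (x' # bs) q - angs [] q \<le> 2 * pi" using eqj by simp
    qed (use pos False x' le 2 bs in \<open>auto simp: radii_def\<close>)
  qed
  moreover have "pots as k' - pots [x] k' - 0 / cosh k' \<le> pots as k - pots [x] k - 0 / cosh k"
  proof (rule pots_decreasing)
    fix q assume "k < q" "q < k'"
    then show "0 \<le> angs as q - angs [x] q" using radii_crossing[OF 1] by (simp add: less_imp_le)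
  qed (use pos kk radii_as[OF 1] 1 in \<open>auto simp: radii_def\<close>)
  \<comment> \<open>With the radii replaced, changing \<open>x\<close> to \<open>x'\<close> adds
    \<open>pot x' - pot x\<close> at \<open>j\<close> and subtracts it at \<open>k'\<close>. This
    difference decreases in the radius because the longer side subtends more; here
    \<open>k' \<le> j\<close> enters.\<close>
  moreover have "pots [x'] j - pots [x] j - 0 / cosh j \<le> pots [x'] k' - pots [x] k' - 0 / cosh k'"
  proof (rule pots_decreasing)
    fix q assume "k' < q" "q < j"
    then show "0 \<le> angs [x'] q - angs [x] q" using ang_mono[of q x x'] x pos by simp
  qed (use pos le x' x in auto)
  ultimately show ?thesis by (simp add: total_def)
qed

text \<open>At equal radii the terms in \<open>x\<close> cancel, which leaves the polygon with sides \<open>as @ bs\<close>.\<close>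

lemma total_top:
  assumes 1: "radii x j k" "k \<le> j" and 2: "radii x' m m" and le: "j \<le> m"
  shows "total x' m m \<le> total x j k"
proof -
  note pos = radii_pos[OF 1(1)] radii_pos[OF 2]
  have "pots as j - pots [x] j - 0 / cosh j \<le> pots as k - pots [x] k - 0 / cosh k"
  proof (rule pots_decreasing)
    fix q assume "k < q" "q < j"
    then show "0 \<le> angs as q - angs [x] q" using radii_crossing[OF 1(1)] by (simp add: less_imp_le)
  qed (use pos 1 radii_as[OF 1(1)] in \<open>auto simp: radii_def\<close>)
  moreover have "pots (as @ bs) m - pots [] m - 2 * pi / cosh m
      \<le> pots (as @ bs) j - pots [] j - 2 * pi / cosh j"
  proof (rule pots_decreasing)
    fix q assume q: "j < q" "q < m"
    have "angs (as @ bs) m \<le> angs (as @ bs) q"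
      using q pos as bs by (intro angs_antimono) auto
    then show "2 * pi \<le> angs (as @ bs) q - angs [] q" using 2 by (simp add: radii_def)
  next
    show "\<forall>d\<in>set ((as @ bs) @ []). 0 < d \<and> d / 2 \<le> j"
    proof
      fix d assume "d \<in> set ((as @ bs) @ [])"
      then consider "d \<in> set as" | "d \<in> set bs" by auto
      then show "0 < d \<and> d / 2 \<le> j"
      proof cases
        case 1
        then show ?thesis using radii_as[OF \<open>radii x j k\<close>, of d] \<open>k \<le> j\<close> by linarith
      next
        case 2
        then show ?thesis using \<open>radii x j k\<close> bs by (simp add: radii_def)
      qed
    qed
  qed (use pos le in auto)
  ultimately show ?thesis by (simp add: total_def)
qed

text \<open>Takes the place of continuity of the radii in \<open>x\<close>. At a radius
  \<open>r\<close> strictly between \<open>kz\<close> and \<open>jz\<close> both angle conditions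
  for \<open>z\<close> fail strictly, in known directions. Near \<open>z\<close> the same
  inequalities persist, and they force \<open>k' \<le> r \<le> j\<close>.\<close>

lemma radii_local:
  assumes z: "radii z jz kz" "kz < jz"
  obtains e where "0 < e"
    "\<And>x j k x' j' k'. radii x j k \<Longrightarrow> radii x' j' k' \<Longrightarrow> \<bar>x - z\<bar> < e \<Longrightarrow> \<bar>x' - z\<bar> < e \<Longrightarrow> k' \<le> j"
proof -
  define r where "r = (kz + jz) / 2"
  have r: "kz < r" "r < jz" using z by (auto simp: r_def)
  note pos = radii_pos[OF z(1)]
  have r0: "0 < r" and zr: "z / 2 < r" using r pos z by (auto simp: radii_def)
  have a: "ang z r < angs as r" by (rule radii_crossing[OF z(1) r(1)])
  have ar: "\<forall>a\<in>set as. 0 < a \<and> a / 2 \<le> r"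
  proof
    fix a assume "a \<in> set as"
    then show "0 < a \<and> a / 2 \<le> r" using radii_as[OF z(1), of a] r(1) by linarith
  qed
  have "angs as r \<le> angs as kz" using r pos as by (intro angs_antimono) auto
  also have "\<dots> \<le> pi" using z pos ang_le_pi[of z kz] by (simp add: radii_def)
  finally have sr: "angs as r \<le> pi" .
  have "ang z jz < ang z r" using zr r pos by (intro ang_strict_antimono) auto
  moreover have "angs bs jz \<le> angs bs r" using r r0 bs by (intro angs_antimono) auto
  ultimately have b: "2 * pi - angs bs r < ang z r" using z by (simp add: radii_def)
  have "continuous_on {0<..} (\<lambda>x. ang x r)"
    by (rule continuous_on_subset[OF continuous_on_ang_length[OF r0]]) auto
  then have "isCont (\<lambda>x. ang x r) z"
    using pos by (simp add: continuous_on_eq_continuous_at)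
  then have lim: "((\<lambda>x. ang x r) \<longlongrightarrow> ang z r) (at z)"
    by (simp add: isCont_def)
  have "\<forall>\<^sub>F x in at z. ang x r < angs as r \<and> 2 * pi - angs bs r < ang x r \<and> x < 2 * r"
    using zr by (intro eventually_conj order_tendstoD[OF lim] order_tendstoD[OF tendsto_ident_at] a b)
      auto
  then have "\<forall>\<^sub>F x in nhds z. ang x r < angs as r \<and> 2 * pi - angs bs r < ang x r \<and> x < 2 * r"
    using a b zr by (simp add: eventually_nhds_conv_at)
  then obtain e where e: "0 < e"
    "\<And>x. \<bar>x - z\<bar> < e \<Longrightarrow> ang x r < angs as r \<and> 2 * pi - angs bs r < ang x r \<and> x < 2 * r"
    unfolding eventually_nhds_metric dist_real_def by blast
  show ?thesis
  proof (rule that[OF e(1)])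
    fix x j k x' j' k'
    assume 1: "radii x j k" and 2: "radii x' j' k'" and xe: "\<bar>x - z\<bar> < e" and xe': "\<bar>x' - z\<bar> < e"
    note p1 = radii_pos[OF 1] and p2 = radii_pos[OF 2]
    have "k' \<le> r"
    proof (rule ccontr)
      assume "\<not> k' \<le> r"
      then have "ang x' k' < angs as k'"
        using e(2)[OF xe'] sr ar as p2 by (intro angs_crossing[of as r]) auto
      then show False using 2 by (simp add: radii_def)
    qed
    moreover have "r \<le> j"
    proof (rule ccontr)
      assume n: "\<not> r \<le> j"
      have "ang x r \<le> ang x j" "angs bs r \<le> angs bs j"
        using n p1 bs by (auto intro!: ang_antimono angs_antimono)
      then show False using e(2)[OF xe] 1 by (simp add: radii_def)
    qed
    ultimately show "k' \<le> j" by simp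
  qed
qed

text \<open>\<open>total_step\<close> compares only nearby lengths. The comparison composes over
  adjacent intervals and holds near every point, so bisection extends it to the whole
  interval.\<close>

lemma total_antimono:
  assumes uw: "u \<le> w" and rad: "\<And>x. u \<le> x \<Longrightarrow> x \<le> w \<Longrightarrow> \<exists>j k. radii x j k \<and> k < j"
    and 1: "radii u j k" and 2: "radii w j' k'"
  shows "total w j' k' \<le> total u j k"
proof -
  define P where "P x x' \<longleftrightarrow> (u \<le> x \<longrightarrow> x' \<le> w \<longrightarrow> (\<forall>j k j' k'. radii x j k \<longrightarrow> radii x' j' k' \<longrightarrow>
      total x' j' k' \<le> total x j k))" for x x'
  have "P u w"
  proof (rule Bolzano[OF uw])
    fix a b c assume p: "P a b" "P b c" "a \<le> b" "b \<le> c"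
    show "P a c"
      unfolding P_def
    proof (intro impI allI)
      fix j k j' k' assume h: "u \<le> a" "c \<le> w" "radii a j k" "radii c j' k'"
      obtain jb kb where "radii b jb kb" using rad[of b] h p by auto
      then have "total c j' k' \<le> total b jb kb" "total b jb kb \<le> total a j k"
        using p h unfolding P_def by auto
      then show "total c j' k' \<le> total a j k" by linarith
    qed
  next
    fix z assume z: "u \<le> z" "z \<le> w"
    then obtain jz kz where "radii z jz kz" "kz < jz" using rad by blast
    then obtain e where e: "0 < e"
      "\<And>x j k x' j' k'. radii x j k \<Longrightarrow> radii x' j' k' \<Longrightarrow> \<bar>x - z\<bar> < e \<Longrightarrow> \<bar>x' - z\<bar> < e \<Longrightarrow> k' \<le> j"
      using radii_local by blast
    have "P a b" if ab: "a \<le> z" "z \<le> b" "b - a < e" for a b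
      unfolding P_def
    proof (intro impI allI)
      fix j k j' k' assume h: "u \<le> a" "b \<le> w" "radii a j k" "radii b j' k'"
      show "total b j' k' \<le> total a j k"
      proof (cases "a < b")
        case True
        have "k' \<le> j" by (rule e(2)[OF h(3,4)]) (use ab in auto)
        then show ?thesis by (rule total_step[OF h(3,4) True])
      next
        case False
        then have eq: "a = b" using ab by simp
        then show ?thesis using radii_unique[of b j k j' k'] h by simp
      qed
    qed
    then show "\<exists>d>0. \<forall>a b. a \<le> z \<and> z \<le> b \<and> b - a < d \<longrightarrow> P a b" using e(1) by blast
  qed
  then show ?thesis using 1 2 unfolding P_def by blast
qed


section \<open>The interval of admissible lengths\<close>

text \<open>The center at the root is interior: \<open>j\<close> exceeds half of each of the sides
  \<open>bs\<close>, and half of \<open>x\<close> because \<open>x / 2 \<le> k < j\<close>.\<close>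

definition admissible :: "real \<Rightarrow> bool" where
  "admissible x \<longleftrightarrow> (\<exists>j k. radii x j k \<and> k < j \<and> Max (set bs) / 2 < j)"

lemma nonempty: "as \<noteq> []" "bs \<noteq> []"
  using as bs by auto

lemma Max_pos: "0 < Max (set as)" "0 < Max (set bs)"
  using as bs nonempty by auto


text \<open>Three conditions on \<open>x\<close> are separated: \<open>x1 \<le> x\<close> keeps the
  initial polygon non-centered, \<open>low x\<close> makes \<open>j\<close> exceed half of the
  longest side in \<open>bs\<close>, and \<open>x < dp\<close> means \<open>k < j\<close>. The first
  is weak and the second strict, so the interval contains its lower endpoint exactly if
  \<open>x1\<close> satisfies \<open>low\<close>.\<close>

lemma admissible_interval:
  assumes "admissible y"
  obtains dm dp where "dm < dp"
    "Collect admissible = {dm<..<dp} \<and> dm < Max (set bs) \<and>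
       angs bs (Max (set bs) / 2) + ang dm (Max (set bs) / 2) = 2 * pi \<or>
     Collect admissible = {dm..<dp} \<and> angs as (dm / 2) = pi"
    "\<And>x. dm \<le> x \<Longrightarrow> x \<le> dp \<Longrightarrow> \<exists>j k. radii x j k \<and> k \<le> j"
    "\<And>x j k j' k'. dm \<le> x \<Longrightarrow> x \<le> dp \<Longrightarrow> radii dm j k \<Longrightarrow> radii x j' k' \<Longrightarrow> total x j' k' \<le> total dm j k"
proof -
  note result = that
  define mb where "mb = Max (set bs)"
  have mb: "0 < mb" "\<And>b. b \<in> set bs \<Longrightarrow> b \<le> mb" using Max_pos by (auto simp: mb_def)
  define ma where "ma = Max (set as)"
  have ma: "0 < ma" "\<And>a. a \<in> set as \<Longrightarrow> a \<le> ma" using Max_pos by (auto simp: ma_def)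
  have as0: "\<forall>a\<in>set as. 0 < a" and bs0: "\<forall>b\<in>set bs. 0 < b" using as bs by auto
  have big: "pi < angs as (ma / 2)" "pi < angs bs (mb / 2)"
    unfolding ma_def mb_def using as bs by (auto intro: angs_gt_pi_half_Max)
  \<comment> \<open>In the circle of radius \<open>r1\<close> the sides \<open>as\<close> fill a
    half turn, so the side closing them up is the diameter \<open>x1\<close>.\<close>
  obtain r1 where r1: "ma / 2 \<le> r1" "angs as r1 = pi"
    using angs_IVT[OF as0, of "ma / 2" pi] ma big by (auto simp: pi_gt_zero)
  define x1 where "x1 = 2 * r1"
  have x1: "ma < x1" "0 < x1" "angs as (x1 / 2) = pi"
  proof -
    have "r1 \<noteq> ma / 2" using r1 big by auto
    then show "ma < x1" using r1 by (simp add: x1_def)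
    then show "0 < x1" using ma by linarith
    show "angs as (x1 / 2) = pi" using r1 by (simp add: x1_def)
  qed
  have as_strict: "angs as s < angs as r" if "ma / 2 \<le> r" "r < s" for r s
  proof (rule angs_strict_antimono)
    show "\<forall>d\<in>set as. 0 < d \<and> d / 2 \<le> r"
    proof
      fix a assume "a \<in> set as"
      then show "0 < a \<and> a / 2 \<le> r" using ma(2)[of a] as0 that(1) by simp
    qed
  qed (use that ma nonempty in auto)
  have x1_iff: "angs as (x / 2) \<le> pi \<longleftrightarrow> x1 \<le> x" if "ma \<le> x" for x
  proof
    assume "angs as (x / 2) \<le> pi"
    then show "x1 \<le> x" using as_strict[of "x / 2" "x1 / 2"] that x1 by (cases "x1 \<le> x") auto
  next
    assume "x1 \<le> x"
    then show "angs as (x / 2) \<le> pi" using angs_antimono[OF as0, of "x1 / 2" "x / 2"] x1 by simp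
  qed
  have ge_x1: "x1 \<le> x" "ma \<le> x" if "radii x j k" for x j k
  proof -
    have "ma \<in> set as" using nonempty by (simp add: ma_def)
    then show "ma \<le> x" using that by (simp add: radii_def)
    then show "x1 \<le> x" using x1_iff[of x] that by (simp add: radii_def)
  qed
  obtain jy ky where y: "radii y jy ky" "ky < jy" "mb / 2 < jy"
    using assms by (auto simp: admissible_def mb_def)
  note ypos = radii_pos[OF y(1)]
  have excess: "2 * pi < angs as j + angs bs j" if "radii x j k" "k < j" for x j k
    using radii_crossing[OF that(1,2)] that by (simp add: radii_def)
  \<comment> \<open>The radius of the polygon with sides \<open>as @ bs\<close>, which arises when
    the two circles coincide.\<close>
  obtain m where m: "jy \<le> m" "angs (as @ bs) m = 2 * pi"
    using angs_IVT[of "as @ bs" jy "2 * pi"] as0 bs0 ypos excess[OF y(1,2)] by auto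
  have m0: "0 < m" "mb / 2 < m" using m y ypos by auto
  have bs_weak: "angs bs s \<le> angs bs r" if "0 < r" "r \<le> s" for r s
    using that bs0 by (intro angs_antimono) auto
  have jm: "j < m" if "radii x j k" "k < j" for x j k
  proof (rule ccontr)
    assume "\<not> j < m"
    then have "angs (as @ bs) j \<le> angs (as @ bs) m" using as0 bs0 m0 by (intro angs_antimono) auto
    then show False using excess[OF that] m by simp
  qed
  have "x1 / 2 < m" using ge_x1(1)[OF y(1)] y m by (auto simp: radii_def)
  then have asm: "angs as m < pi" "0 < angs as m"
    using as_strict[of "x1 / 2" m] x1 angs_pos[OF as0 m0(1)] nonempty by auto
  \<comment> \<open>The diagonal of that polygon which cuts off the sides \<open>as\<close>: the
    chord subtending \<open>angs as m\<close>.\<close>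
  define dp where "dp = 2 * arsinh (sinh m * sin (angs as m / 2))"
  have sdp: "sinh (dp / 2) = sinh m * sin (angs as m / 2)" by (simp add: dp_def)
  have sin_bnd: "0 < sin (angs as m / 2)" "sin (angs as m / 2) < 1"
  proof -
    show "0 < sin (angs as m / 2)" using asm by (intro sin_gt_zero) auto
    have "sin (angs as m / 2) < sin (pi / 2)" using asm by (intro sin_monotone_2pi) auto
    then show "sin (angs as m / 2) < 1" by simp
  qed
  have "0 < sinh (dp / 2)" using sdp sin_bnd m0 by simp
  then have dp0: "0 < dp" by simp
  have "sinh (dp / 2) < sinh m" using sdp sin_bnd m0 by simp
  then have dpm: "dp / 2 < m" by simp
  have dpa: "ang dp m = angs as m" by (rule ang_unique) (use sdp asm m0 in auto)
  have dpb: "angs bs m + ang dp m = 2 * pi" using dpa m by simp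
  define low where "low w \<longleftrightarrow> 2 * pi < angs bs (mb / 2) + ang w (mb / 2)" for w
  have lt_dp: "w < dp" if "radii w j k" "k < j" for w j k
  proof (rule ccontr)
    assume "\<not> w < dp"
    note p = radii_pos[OF that(1)]
    have "ang dp m \<le> ang w m" using \<open>\<not> w < dp\<close> dp0 m0 by (intro ang_mono) auto
    moreover have "ang w m < ang w j"
      using jm[OF that] that p by (intro ang_strict_antimono) (auto simp: radii_def)
    moreover have "angs bs m \<le> angs bs j" using jm[OF that] p by (intro bs_weak) auto
    ultimately show False using dpb that by (simp add: radii_def)
  qed
  have low_adm: "low w" if "radii w j k" "k < j" "mb / 2 < j" for w j k
  proof -
    note p = radii_pos[OF that(1)]
    have "ang w j < ang w (mb / 2)"
      using that p mb by (intro ang_strict_antimono) (auto simp: radii_def)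
    moreover have "angs bs j \<le> angs bs (mb / 2)" using that mb by (intro bs_weak) auto
    ultimately show ?thesis using that by (simp add: radii_def low_def)
  qed
  have ex_radii: "\<exists>j k. radii w j k \<and> k < j \<and> (low w \<longrightarrow> mb / 2 < j)"
    if w: "x1 \<le> w" "w < dp" "2 * pi \<le> angs bs (mb / 2) + ang w (mb / 2)" for w
  proof -
    have w0: "0 < w" "ma < w" using w x1 by auto
    have "ang w m < ang dp m" using w w0 dpm m0 by (intro ang_strict_mono) auto
    then have lt: "angs bs m + ang w m < 2 * pi" using dpb by linarith
    have "\<exists>j. mb / 2 \<le> j \<and> j \<le> m \<and> angs bs j + ang w j = 2 * pi"
      by (rule IVT2')
        (use w lt m0 mb w0 in \<open>auto intro!: continuous_intros continuous_on_subset[OF continuous_on_angs[OF bs0]]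
            continuous_on_subset[OF continuous_on_ang]\<close>)
    then obtain j where j: "mb / 2 \<le> j" "j \<le> m" "angs bs j + ang w j = 2 * pi" by blast
    have "j \<noteq> m" using lt j by auto
    then have "j < m" using j by simp
    have j0: "0 < j" using j mb by linarith
    \<comment> \<open>Otherwise the tree edge would subtend \<open>pi\<close> at \<open>j\<close>.
      But \<open>bs\<close> subtends more than \<open>pi\<close> at radius \<open>m\<close>, hence
      also at \<open>j\<close>.\<close>
    have wj: "w / 2 < j"
    proof (rule ccontr)
      assume "\<not> w / 2 < j"
      then have "ang w j = pi" using j0 by (intro ang_eq_pi) auto
      moreover have "angs bs m \<le> angs bs j" using j j0 by (intro bs_weak) auto
      ultimately show False using j m asm by simp
    qed
    have "angs as m < angs as j" using wj w0 \<open>j < m\<close> by (intro as_strict) auto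
    moreover have "angs bs m \<le> angs bs j" using j j0 by (intro bs_weak) auto
    ultimately have lt2: "ang w j < angs as j" using m j by simp
    have w2: "angs as (w / 2) \<le> pi" using x1_iff[of w] w w0 by simp
    have "\<exists>k. w / 2 \<le> k \<and> k \<le> j \<and> angs as k - ang w k = 0"
      by (rule IVT')
        (use w2 lt2 wj w0 in \<open>auto simp: ang_eq_pi intro!: continuous_intros
            continuous_on_subset[OF continuous_on_angs[OF as0]]
            continuous_on_subset[OF continuous_on_ang]\<close>)
    then obtain k where k: "w / 2 \<le> k" "k \<le> j" "angs as k = ang w k" by auto
    have "k \<noteq> j" using k lt2 by auto
    have "radii w j k"
      unfolding radii_def using w0 wj j k w2 mb ma by (fastforce intro: order_trans)
    moreover have "mb / 2 \<noteq> j" if "low w" using that j by (auto simp: low_def)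
    ultimately show ?thesis using k \<open>k \<noteq> j\<close> j by (intro exI[of _ j] exI[of _ k]) auto
  qed
  have adm_iff: "admissible w \<longleftrightarrow> x1 \<le> w \<and> low w \<and> w < dp" for w
  proof
    assume "admissible w"
    then show "x1 \<le> w \<and> low w \<and> w < dp"
      using ge_x1 low_adm lt_dp by (auto simp: admissible_def mb_def)
  next
    assume "x1 \<le> w \<and> low w \<and> w < dp"
    then show "admissible w"
      using ex_radii[of w] by (auto simp: admissible_def mb_def low_def)
  qed
  have y_low: "x1 \<le> y" "low y" "y < dp" using adm_iff assms by auto
  have rad_dp: "radii dp m m"
    unfolding radii_def
  proof (intro conjI ballI)
    fix b assume "b \<in> set bs"
    then show "b / 2 \<le> m" using mb(2)[of b] m0 by linarith
  next
    fix a assume "a \<in> set as"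
    then show "a \<le> dp" using ma(2)[of a] y_low x1 by linarith
  next
    show "angs as (dp / 2) \<le> pi" using x1_iff[of dp] y_low x1 by simp
  qed (use dp0 dpm dpb dpa in auto)
  have fin: thesis
    if dm: "x1 \<le> dm" "dm < dp" "2 * pi \<le> angs bs (mb / 2) + ang dm (mb / 2)"
      and cases: "Collect admissible = {dm<..<dp} \<and> dm < Max (set bs) \<and>
          angs bs (Max (set bs) / 2) + ang dm (Max (set bs) / 2) = 2 * pi \<or>
        Collect admissible = {dm..<dp} \<and> angs as (dm / 2) = pi" for dm
  proof (rule result[OF dm(2) cases])
    have ex: "\<exists>j k. radii x j k \<and> k < j" if "dm \<le> x" "x < dp" for x
    proof -
      have "ang dm (mb / 2) \<le> ang x (mb / 2)" using that dm x1 mb by (intro ang_mono) auto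
      then show ?thesis using ex_radii[of x] that dm by force
    qed
    show "\<exists>j k. radii x j k \<and> k \<le> j" if "dm \<le> x" "x \<le> dp" for x
      using ex[of x] rad_dp that by (cases "x = dp") (force intro: less_imp_le)+
    show "total x j' k' \<le> total dm j k"
      if "dm \<le> x" "x \<le> dp" "radii dm j k" "radii x j' k'" for x j k j' k'
    proof (cases "x = dp")
      case False
      show ?thesis
        by (rule total_antimono[OF \<open>dm \<le> x\<close> ex that(3,4)]) (use that False in auto)
    next
      case True
      \<comment> \<open>The radii coincide at \<open>dp\<close>, so \<open>total_antimono\<close>
        does not reach it.\<close>
      obtain j0 k0 where 0: "radii dm j0 k0" "k0 < j0" using ex[of dm] dm by auto
      have "j = j0" "k = k0" using radii_unique[OF that(3) 0(1)] by auto
      moreover have "j' = m" "k' = m" using radii_unique[OF that(4)[unfolded True] rad_dp] by auto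
      ultimately show ?thesis
        using total_top[OF 0(1) _ rad_dp] 0 jm[OF 0] True by simp
    qed
  qed
  show thesis
  proof (cases "low x1")
    case True
    have "low w" if "x1 \<le> w" for w
      using ang_mono[of "mb / 2" x1 w] that True x1 mb by (simp add: low_def)
    then have "Collect admissible = {x1..<dp}" using adm_iff by auto
    then show thesis using fin[of x1] x1 y_low True by (simp add: low_def)
  next
    case False
    \<comment> \<open>At \<open>z\<close> the root polygon has its center on a side of length
      \<open>mb\<close>; as \<open>low\<close> is strict, \<open>z\<close> itself is
      excluded.\<close>
    have "\<exists>z. x1 \<le> z \<and> z \<le> y \<and> ang z (mb / 2) = 2 * pi - angs bs (mb / 2)"
      by (rule IVT') (use False y_low x1 mb in
        \<open>auto simp: low_def intro!: continuous_on_subset[OF continuous_on_ang_length]\<close>)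
    then obtain z where z: "x1 \<le> z" "z \<le> y" "ang z (mb / 2) = 2 * pi - angs bs (mb / 2)" by blast
    \<comment> \<open>In the circle with diameter \<open>mb\<close> the sides \<open>bs\<close>
      subtend more than \<open>pi\<close>, which leaves less than \<open>pi\<close> for
      \<open>z\<close>. This is why the tree edge is not the longest side at the root.\<close>
    have zmb: "z < mb"
    proof (rule ccontr)
      assume "\<not> z < mb"
      then have "ang z (mb / 2) = pi" using mb by (intro ang_eq_pi) auto
      then show False using z big by simp
    qed
    have "low w \<longleftrightarrow> z < w" if "x1 \<le> w" for w
    proof
      assume "z < w"
      then have "ang z (mb / 2) < ang w (mb / 2)" using z x1 zmb mb by (intro ang_strict_mono) auto
      then show "low w" using z by (simp add: low_def)
    next
      assume l: "low w"
      show "z < w"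
      proof (rule ccontr)
        assume "\<not> z < w"
        then have "ang w (mb / 2) \<le> ang z (mb / 2)" using that x1 mb by (intro ang_mono) auto
        then show False using l z by (simp add: low_def)
      qed
    qed
    then have "Collect admissible = {z<..<dp}" using adm_iff z by fastforce
    then show thesis using fin[of z] z zmb y_low by (simp add: mb_def)
  qed
qed

end

section \<open>The sets \<open>AC\<close>, \<open>C\<close> and \<open>BC\<close> in terms of angle
  sums\<close>

lemma sum_list_pos:
  fixes f :: "'a \<Rightarrow> 'b::ordered_comm_monoid_add"
  assumes "ds \<noteq> []" "\<forall>d\<in>set ds. 0 < f d"
  shows "0 < sum_list (map f ds)"
  using assms
proof (induction ds)
  case (Cons d ds)
  then show ?case by (cases "ds = []") (auto intro: add_pos_pos)
qed simp

lemma sin_sum_list_le: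
  fixes f :: "'a \<Rightarrow> real"
  assumes "\<forall>d\<in>set ds. 0 < f d" "sum_list (map f ds) \<le> pi"
  shows "sin (sum_list (map f ds)) \<le> (\<Sum>d\<leftarrow>ds. sin (f d))"
    and "2 \<le> length ds \<Longrightarrow> sin (sum_list (map f ds)) < (\<Sum>d\<leftarrow>ds. sin (f d))"
proof -
  have "sin (sum_list (map f ds)) \<le> (\<Sum>d\<leftarrow>ds. sin (f d)) \<and>
    (2 \<le> length ds \<longrightarrow> sin (sum_list (map f ds)) < (\<Sum>d\<leftarrow>ds. sin (f d)))"
    using assms
  proof (induction ds)
    case (Cons d ds)
    define s where "s = sum_list (map f ds)"
    have nn: "0 \<le> s"
      using Cons.prems sum_list_pos[of ds f] unfolding s_def
      by (cases "ds = []") (auto simp: less_imp_le)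
    have d: "0 < f d" "f d + s \<le> pi" using Cons.prems by (auto simp: s_def)
    then have ih: "sin s \<le> (\<Sum>d\<leftarrow>ds. sin (f d))" using Cons by (simp add: s_def)
    have s0: "0 \<le> sin (f d)" "0 \<le> sin s" using d nn by (auto intro!: sin_ge_zero)
    have le: "sin (f d) * cos s \<le> sin (f d)" "sin s * cos (f d) \<le> sin s"
      using s0 by (auto intro!: mult_left_le)
    have "sin (f d + s) < sin (f d) + sin s" if "ds \<noteq> []"
    proof -
      have "0 < s"
        using Cons.prems that sum_list_pos[of ds f] unfolding s_def by simp
      then have "0 < sin s" "cos (f d) < cos 0"
        using d by (auto intro!: sin_gt_zero cos_monotone_0_pi simp del: cos_zero)
      then have "sin s * cos (f d) < sin s" by simp
      then show ?thesis using le by (simp add: sin_add mult.commute)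
    qed
    then show ?case
      using le ih by (cases "ds = []") (auto simp: sin_add mult.commute s_def Suc_le_eq)
  qed simp
  then show "sin (sum_list (map f ds)) \<le> (\<Sum>d\<leftarrow>ds. sin (f d))"
    and "2 \<le> length ds \<Longrightarrow> sin (sum_list (map f ds)) < (\<Sum>d\<leftarrow>ds. sin (f d))" by auto
qed

lemma angs_half: "(\<Sum>d\<leftarrow>ds. ang d r / 2) = angs ds r / 2"
  by (induction ds) (auto simp: add_divide_distrib)

lemma sum_A_eq_angs:
  assumes "\<forall>x\<in>set d. 0 < x"
  shows "(\<Sum>j<length d. A (d ! j) (Max (set d) / 2)) = angs d (Max (set d) / 2)"
proof -
  have "A (d ! j) (Max (set d) / 2) = ang (d ! j) (Max (set d) / 2)" if "j < length d" for j
    using that assms by (intro A_eq_ang) auto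
  then have "(\<Sum>j<length d. A (d ! j) (Max (set d) / 2)) = (\<Sum>j<length d. ang (d ! j) (Max (set d) / 2))"
    by simp
  then show ?thesis unfolding sum_nth_eq[of "\<lambda>x. ang x (Max (set d) / 2)"] by (simp add: angs_def)
qed

lemma C_iff: "d \<in> C n \<longleftrightarrow> 3 \<le> n \<and> length d = n \<and> (\<forall>x\<in>set d. 0 < x) \<and> 2 * pi < angs d (Max (set d) / 2)"
  using sum_A_eq_angs[of d] by (auto simp: C_def)

lemma BC_iff: "d \<in> BC n \<longleftrightarrow> 3 \<le> n \<and> length d = n \<and> (\<forall>x\<in>set d. 0 < x) \<and> angs d (Max (set d) / 2) = 2 * pi"
  using sum_A_eq_angs[of d] by (auto simp: BC_def)

lemma AC_iff: "d \<in> AC n \<longleftrightarrow> 3 \<le> n \<and> length d = n \<and> (\<forall>x\<in>set d. 0 < x) \<and>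
    (\<forall>x\<in>set d. 2 * sinh (x / 2) < (\<Sum>y\<leftarrow>d. sinh (y / 2)))"
proof -
  have "sinh (d ! i / 2) < (\<Sum>j\<in>{..<length d} - {i}. sinh (d ! j / 2)) \<longleftrightarrow>
      2 * sinh (d ! i / 2) < (\<Sum>y\<leftarrow>d. sinh (y / 2))" if "i < length d" for i
    unfolding sum_nth_eq[of "\<lambda>y. sinh (y / 2)", symmetric] using that by (auto simp: sum_diff1)
  then show ?thesis by (auto simp: AC_def all_set_conv_all_nth)
qed

text \<open>In very large circles the angles are nearly proportional to the hyperbolic sines of the
  half sides, so by \<open>lt\<close> the sides \<open>ds\<close> subtend more than
  \<open>x\<close>; at radius \<open>x / 2\<close> they subtend at most as much. In between there is
  equality.\<close>

lemma noncentered_radius_exists: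
  assumes x: "0 < x" and pos: "\<forall>a\<in>set ds. 0 < a \<and> a \<le> x" and le: "angs ds (x / 2) \<le> pi"
    and lt: "sinh (x / 2) < (\<Sum>a\<leftarrow>ds. sinh (a / 2))"
  shows "\<exists>k\<ge>x / 2. angs ds k = ang x k"
proof -
  define s where "s = (\<Sum>a\<leftarrow>ds. sinh (a / 2))"
  have pos0: "\<forall>a\<in>set ds. 0 < a" using pos by blast
  have sx: "0 < sinh (x / 2)" "sinh (x / 2) < s" using x lt by (auto simp: s_def)
  \<comment> \<open>By \<open>t * cos t \<le> sin t\<close>, the cosine bounds the loss in replacing
    \<open>sin t\<close> by \<open>t\<close>. For large \<open>r\<close> the gap between
    \<open>sinh (x / 2)\<close> and \<open>s\<close> absorbs this loss.\<close>
  have "((\<lambda>r. cos (ang x r / 2)) \<longlongrightarrow> cos (0 / 2)) at_top"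
    by (intro tendsto_intros tendsto_ang_0 x) auto
  moreover have "sinh (x / 2) / s < 1" using sx order.strict_trans[OF sx] by (subst divide_less_eq_1_pos)
  then have "sinh (x / 2) / s < cos (0 / 2)" by simp
  ultimately have "\<forall>\<^sub>F r in at_top. sinh (x / 2) / s < cos (ang x r / 2)"
    by (rule order_tendstoD)
  then have "\<forall>\<^sub>F r in at_top. sinh (x / 2) / s < cos (ang x r / 2) \<and> x / 2 < r"
    using eventually_gt_at_top by (rule eventually_conj)
  then obtain r where r: "sinh (x / 2) / s < cos (ang x r / 2)" "x / 2 < r"
    using eventually_happens by (metis (no_types, lifting) trivial_limit_at_top_linorder)
  have r0: "0 < r" using r x by linarith
  define t where "t = ang x r / 2"
  have t: "0 < t" "t < pi / 2" using ang_pos[OF x r0] ang_lt_pi[OF x r(2)] by (auto simp: t_def)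
  have cost: "0 < cos t" using t by (intro cos_gt_zero) auto
  have "\<bar>t\<bar> \<le> \<bar>tan t\<bar>" using t by (intro abs_tan_ge) auto
  moreover have "0 < sin t" using t by (intro sin_gt_zero) auto
  ultimately have tan: "t * cos t \<le> sin t"
    using t cost by (simp add: tan_def field_simps)
  have "ang x r < angs ds r"
  proof (rule ccontr)
    assume "\<not> ang x r < angs ds r"
    then have le: "(\<Sum>a\<leftarrow>ds. ang a r / 2) \<le> t" by (simp add: angs_half t_def)
    have "(\<Sum>a\<leftarrow>ds. sinh (a / 2)) = (\<Sum>a\<leftarrow>ds. sinh r * sin (ang a r / 2))"
      using pos r by (intro arg_cong[of _ _ sum_list] map_cong refl sinh_sin_ang[symmetric]) auto
    also have "\<dots> \<le> (\<Sum>a\<leftarrow>ds. sinh r * (ang a r / 2))"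
      using pos0 r0 by (intro sum_list_mono mult_left_mono sin_x_le_x) (auto intro: less_imp_le[OF ang_pos])
    also have "\<dots> \<le> sinh r * t"
      unfolding sum_list_const_mult using le r0 by (intro mult_left_mono) auto
    finally have "s * cos t \<le> sinh r * t * cos t"
      using cost unfolding s_def by (intro mult_right_mono) auto
    also have "\<dots> \<le> sinh r * sin t" using tan r0 by simp
    also have "\<dots> = sinh (x / 2)" unfolding t_def using x r by (intro sinh_sin_ang) auto
    finally show False using r sx by (simp add: t_def field_simps)
  qed
  then have "\<exists>k. x / 2 \<le> k \<and> k \<le> r \<and> angs ds k - ang x k = 0"
    by (intro IVT') (use le r x pos0 in \<open>auto simp: ang_eq_pi intro!: continuous_intros
        continuous_on_subset[OF continuous_on_angs[OF pos0]]
        continuous_on_subset[OF continuous_on_ang]\<close>)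
  then show ?thesis by auto
qed

lemma angs_insert: "angs (as1 @ x # as2) r = angs (as1 @ as2) r + ang x r"
  by simp

locale split_edge = one_edge "as1 @ as2" "bs1 @ bs2" for as1 as2 bs1 bs2
begin

abbreviation "ini_sides x \<equiv> as1 @ x # as2"
abbreviation "root_sides x \<equiv> bs1 @ x # bs2"

lemma radii_polygons:
  assumes "radii x j k"
  shows "J (root_sides x) = j" "J (ini_sides x) = k"
    "angle_sum (root_sides x) + angle_sum (ini_sides x) = total x j k"
proof -
  have b: "3 \<le> length (root_sides x)" "\<forall>d\<in>set (root_sides x). 0 < d \<and> d / 2 \<le> j" "angs (root_sides x) j = 2 * pi"
    using assms bs by (auto simp: radii_def)
  have a: "3 \<le> length (ini_sides x)" "\<forall>d\<in>set (as1 @ as2). 0 < d \<and> d \<le> x" "angs (as1 @ as2) k = ang x k"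
    "0 < x" "x / 2 \<le> k"
    using assms as by (auto simp: radii_def)
  note root = centered_polygon[OF b]
  note ini = noncentered_polygon[OF a(1,4,5,2,3)]
  show "J (root_sides x) = j" "J (ini_sides x) = k" by (rule root ini)+
  show "angle_sum (root_sides x) + angle_sum (ini_sides x) = total x j k"
    unfolding total_eq[OF assms] root ini by simp
qed

lemma radii_Max: "radii x j k \<Longrightarrow> Max (set (ini_sides x)) = x"
  by (intro Max_eqI) (auto simp: radii_def)

lemma set_lists: "set (ini_sides x) = insert x (set (as1 @ as2))" "set (root_sides x) = insert x (set (bs1 @ bs2))"
  by auto

text \<open>As the longest side \<open>x\<close> subtends \<open>pi\<close> in the circle with
  diameter \<open>x\<close>, not being in \<open>C\<close> means that the other sides subtend at
  most \<open>pi\<close> there. Membership in \<open>AC\<close> matches the existence of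
  \<open>k\<close>: one direction is strict subadditivity of the sine, the other is
  \<open>noncentered_radius_exists\<close>.\<close>

lemma admissible_iff:
  "admissible x \<longleftrightarrow>
    ini_sides x \<in> AC (length (ini_sides x)) - C (length (ini_sides x)) \<and> x = Max (set (ini_sides x)) \<and>
    root_sides x \<in> C (length (root_sides x)) \<and> J (ini_sides x) < J (root_sides x)" (is "_ \<longleftrightarrow> ?R")
proof
  assume "admissible x"
  then obtain j k where r: "radii x j k" "k < j" "Max (set (bs1 @ bs2)) / 2 < j"
    by (auto simp: admissible_def)
  note p = radii_pos[OF r(1)]
  have pos: "\<forall>d\<in>set (ini_sides x). 0 < d" "\<forall>d\<in>set (root_sides x). 0 < d"
    using p as(1) bs(1) by auto
  have len: "3 \<le> length (ini_sides x)" "3 \<le> length (root_sides x)" using as(2) bs(2) by auto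
  have k: "x / 2 \<le> k" "angs (as1 @ as2) k = ang x k" "angs (as1 @ as2) (x / 2) \<le> pi"
    and ax: "\<forall>a\<in>set (as1 @ as2). a \<le> x" using r by (auto simp: radii_def)
  have "sinh (x / 2) = sinh k * sin (\<Sum>a\<leftarrow>as1 @ as2. ang a k / 2)"
    unfolding angs_half k(2) using sinh_sin_ang[of x k] p k by simp
  also have "\<dots> < sinh k * (\<Sum>a\<leftarrow>as1 @ as2. sin (ang a k / 2))"
  proof (intro mult_strict_left_mono sin_sum_list_le(2))
    show "(\<Sum>a\<leftarrow>as1 @ as2. ang a k / 2) \<le> pi"
      unfolding angs_half k(2) using ang_le_pi[of x k] p pi_gt_zero by linarith
    show "\<forall>a\<in>set (as1 @ as2). 0 < ang a k / 2" using as(1) p by (simp add: ang_pos)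
  qed (use p as(2) in auto)
  also have "\<dots> = (\<Sum>a\<leftarrow>as1 @ as2. sinh k * sin (ang a k / 2))"
    by (simp only: sum_list_const_mult)
  also have "\<dots> = (\<Sum>a\<leftarrow>as1 @ as2. sinh (a / 2))"
    using radii_as[OF r(1)] by (intro arg_cong[of _ _ sum_list] map_cong refl sinh_sin_ang) auto
  finally have lt: "sinh (x / 2) < (\<Sum>a\<leftarrow>as1 @ as2. sinh (a / 2))" .
  have "2 * sinh (y / 2) < (\<Sum>d\<leftarrow>ini_sides x. sinh (d / 2))" if "y \<in> set (ini_sides x)" for y
  proof -
    have "y \<le> x" using that ax by auto
    then have "sinh (y / 2) \<le> sinh (x / 2)" by simp
    moreover have "(\<Sum>d\<leftarrow>ini_sides x. sinh (d / 2)) = (\<Sum>a\<leftarrow>as1 @ as2. sinh (a / 2)) + sinh (x / 2)"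
      by simp
    ultimately show ?thesis using lt by linarith
  qed
  then have "ini_sides x \<in> AC (length (ini_sides x))" unfolding AC_iff using pos len by blast
  moreover have M: "Max (set (ini_sides x)) = x" by (rule radii_Max[OF r(1)])
  have "angs (ini_sides x) (Max (set (ini_sides x)) / 2) \<le> 2 * pi"
    unfolding M angs_insert using k p by (simp add: ang_eq_pi)
  then have "ini_sides x \<notin> C (length (ini_sides x))" by (simp only: C_iff) linarith
  moreover have "root_sides x \<in> C (length (root_sides x))"
  proof -
    have "Max (set (root_sides x)) / 2 < j"
    proof -
      have "Max (set (root_sides x)) = max x (Max (set (bs1 @ bs2)))"
        unfolding set_lists using nonempty by (intro Max_insert) auto
      then show ?thesis using r k by (simp add: max_def)
    qed
    moreover have "\<forall>d\<in>set (root_sides x). 0 < d \<and> d / 2 \<le> Max (set (root_sides x)) / 2"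
      using pos by (simp del: set_append)
    moreover have "0 < Max (set (root_sides x)) / 2"
      using pos(2) Max_in[of "set (root_sides x)"] by auto
    ultimately have "angs (root_sides x) j < angs (root_sides x) (Max (set (root_sides x)) / 2)"
      by (intro angs_strict_antimono) auto
    then have "2 * pi < angs (root_sides x) (Max (set (root_sides x)) / 2)"
      using r(1) unfolding angs_insert by (simp add: radii_def)
    then show ?thesis unfolding C_iff using pos len by blast
  qed
  moreover have "J (ini_sides x) < J (root_sides x)" using radii_polygons[OF r(1)] r(2) by simp
  ultimately show ?R using M by simp
next
  assume R: ?R
  have len: "3 \<le> length (ini_sides x)" "3 \<le> length (root_sides x)" using as(2) bs(2) by auto
  have M: "Max (set (ini_sides x)) = x" using R by simp
  have xs: "x \<in> set (ini_sides x)" by simp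
  have "ini_sides x \<in> AC (length (ini_sides x))" using R by blast
  note AC' = this[unfolded AC_iff]
  have x: "0 < x" and AC: "2 * sinh (x / 2) < (\<Sum>d\<leftarrow>ini_sides x. sinh (d / 2))"
    using AC' xs by blast+
  have "root_sides x \<in> C (length (root_sides x))" using R by blast
  then have C: "2 * pi < angs (root_sides x) (Max (set (root_sides x)) / 2)"
    unfolding C_iff by blast
  have "ini_sides x \<notin> C (length (ini_sides x))" using R by blast
  then have nC: "angs (ini_sides x) (x / 2) \<le> 2 * pi"
    unfolding C_iff M using AC' by (simp only: not_less) (blast intro: leI)
  have ax: "a \<le> x" if "a \<in> set (as1 @ as2)" for a
  proof -
    have "a \<in> set (ini_sides x)" using that by auto
    then have "a \<le> Max (set (ini_sides x))" by (intro Max.coboundedI) auto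
    then show ?thesis unfolding M .
  qed
  have "angs (as1 @ as2) (x / 2) \<le> pi"
    using nC x unfolding angs_insert by (simp add: ang_eq_pi)
  moreover have "sinh (x / 2) < (\<Sum>a\<leftarrow>as1 @ as2. sinh (a / 2))" using AC by simp
  ultimately obtain k where k: "x / 2 \<le> k" "angs (as1 @ as2) k = ang x k"
    "angs (as1 @ as2) (x / 2) \<le> pi"
    using noncentered_radius_exists[of x "as1 @ as2"] x as(1) ax by blast
  define mr where "mr = Max (set (root_sides x))"
  have mr: "x \<le> mr" "Max (set (bs1 @ bs2)) \<le> mr"
    unfolding mr_def set_lists using nonempty by (auto simp: Max_insert simp del: set_append)
  have pos: "\<forall>d\<in>set (root_sides x). 0 < d" using x bs(1) by auto
  have C': "2 * pi < angs (root_sides x) (mr / 2)" using C by (simp only: mr_def)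
  obtain j where j: "mr / 2 \<le> j" "angs (root_sides x) j = 2 * pi"
    using angs_IVT[OF pos, of "mr / 2" "2 * pi"] C' mr x by auto
  have "mr / 2 \<noteq> j" using j C' by auto
  then have j': "mr / 2 < j" using j by simp
  have "radii x j k"
    unfolding radii_def
  proof (intro conjI ballI)
    fix b assume "b \<in> set (bs1 @ bs2)"
    then have "b \<le> Max (set (bs1 @ bs2))" by simp
    then show "b / 2 \<le> j" using mr j by linarith
  next
    show "angs (bs1 @ bs2) j + ang x j = 2 * pi" using j unfolding angs_insert by simp
    show "x / 2 \<le> j" using mr j by linarith
  qed (use x k ax in auto)
  moreover have "k < j" using R radii_polygons[OF calculation] by simp
  moreover have "Max (set (bs1 @ bs2)) / 2 < j" using mr j' by linarith
  ultimately show "admissible x" by (auto simp: admissible_def)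
qed

lemma ini_sides_in_BC:
  assumes "radii x j k" "angs (as1 @ as2) (x / 2) = pi"
  shows "ini_sides x \<in> BC (length (ini_sides x))"
proof -
  have "\<forall>d\<in>set (ini_sides x). 0 < d" using radii_pos[OF assms(1)] as(1) by auto
  moreover have "3 \<le> length (ini_sides x)" using as(2) by auto
  moreover have "angs (ini_sides x) (Max (set (ini_sides x)) / 2) = 2 * pi"
    unfolding radii_Max[OF assms(1)] angs_insert
    using assms radii_pos[OF assms(1)] by (simp add: ang_eq_pi)
  ultimately show ?thesis unfolding BC_iff by blast
qed

lemma root_sides_in_BC:
  assumes "0 < x" "x < Max (set (bs1 @ bs2))"
    and "angs (bs1 @ bs2) (Max (set (bs1 @ bs2)) / 2) + ang x (Max (set (bs1 @ bs2)) / 2) = 2 * pi"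
  shows "root_sides x \<in> BC (length (root_sides x))" "x \<noteq> Max (set (root_sides x))"
proof -
  have "Max (set (root_sides x)) = max x (Max (set (bs1 @ bs2)))"
    unfolding set_lists using nonempty by (intro Max_insert) auto
  then have M: "Max (set (root_sides x)) = Max (set (bs1 @ bs2))" using assms by simp
  have "\<forall>d\<in>set (root_sides x). 0 < d" using assms(1) bs(1) by auto
  moreover have "3 \<le> length (root_sides x)" using bs(2) by auto
  moreover have "angs (root_sides x) (Max (set (root_sides x)) / 2) = 2 * pi"
    unfolding M angs_insert using assms(3) by simp
  ultimately show "root_sides x \<in> BC (length (root_sides x))" unfolding BC_iff by blast
  show "x \<noteq> Max (set (root_sides x))" using M assms(2) by simp
qed

lemma admissible_root_not_BC:
  assumes "admissible x"
  shows "root_sides x \<notin> BC n"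
proof
  assume "root_sides x \<in> BC n"
  moreover have "root_sides x \<in> C (length (root_sides x))" using assms admissible_iff by blast
  ultimately show False unfolding BC_iff C_iff by auto
qed

end

section \<open>Graphs with one tree edge\<close>

lemma count_list_1_split:
  assumes "count_list xs e = 1"
  obtains ys zs where "xs = ys @ e # zs" "e \<notin> set ys" "e \<notin> set zs"
proof -
  have "e \<in> set xs" using assms by (metis count_notin zero_neq_one)
  then obtain ys zs where s: "xs = ys @ e # zs" "e \<notin> set ys" by (meson split_list_first)
  then have "count_list zs e = 0" using assms by (simp add: count_notin)
  then have "e \<notin> set zs" by (simp add: count_list_0_iff)
  with s that show ?thesis by blast
qed

text \<open>A second step would use the same edge again and return to a vertex already
  visited.\<close>

lemma one_edge_path:
  assumes T: "edges T = {e}" and p: "graph_path T u p w" and uw: "u \<noteq> w"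
  shows "p = ([u, w], [e]) \<and> ends T e = {u, w}"
proof -
  obtain vs es where pe: "p = (vs, es)" by force
  have h: "length vs = Suc (length es)" "hd vs = u" "last vs = w" "distinct vs" "set es \<subseteq> {e}"
    and en: "\<forall>i<length es. ends T (es ! i) = {vs ! i, vs ! Suc i}"
    using p T by (auto simp: graph_path_def pe)
  obtain v0 vs' where vs: "vs = v0 # vs'" using h(1) by (cases vs) auto
  have "vs' \<noteq> []" using h uw vs by auto
  then obtain v1 vs'' where vs': "vs' = v1 # vs''" by (cases vs') auto
  obtain e0 es' where es: "es = e0 # es'" using h(1) vs vs' by (cases es) auto
  have e0: "e0 = e" "ends T e = {v0, v1}" using h(5) en es vs vs' by auto
  have "es' = []"
  proof (rule ccontr)
    assume "es' \<noteq> []"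
    then obtain e1 es'' where es': "es' = e1 # es''" by (cases es') auto
    then obtain v2 vs3 where v2: "vs'' = v2 # vs3" using h(1) vs vs' es by (cases vs'') auto
    have "e1 = e" using h(5) es es' by auto
    then have "ends T e = {v1, v2}" using en[rule_format, of 1] es es' vs vs' v2 by simp
    then show False using e0 h(4) vs vs' v2 by auto
  qed
  then have "vs'' = []" using h(1) vs vs' es by simp
  then show ?thesis using pe vs vs' es e0 h \<open>es' = []\<close> by auto
qed

lemma one_edge_tree:
  assumes tree: "is_tree T" and T: "edges T = {e}" and r: "r \<in> verts T"
    and v: "v \<in> verts T" "v \<noteq> r"
  shows "ends T e = {v, r}" "verts T = {v, r}" "first_edge T r v = e"
    "children T r r = {v}" "children T r v = {}"
proof -
  have path: "\<exists>p. graph_path T u p w" if "u \<in> verts T" "w \<in> verts T" for u w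
    using tree that by (auto simp: is_tree_def)
  obtain p where p: "graph_path T v p r" using path v r by blast
  have pe: "p = ([v, r], [e])" and en: "ends T e = {v, r}" using one_edge_path[OF T p v(2)] by auto
  have "u = v" if u: "u \<in> verts T" "u \<noteq> r" for u
  proof -
    obtain q where "graph_path T u q r" using path u r by blast
    then have "ends T e = {u, r}" using one_edge_path[OF T _ u(2)] by blast
    then show ?thesis using en u v by (auto simp: doubleton_eq_iff)
  qed
  then show vT: "verts T = {v, r}" using v r by blast
  show "ends T e = {v, r}" by (rule en)
  have "(THE p. graph_path T v p r) = ([v, r], [e])"
    by (rule the_equality) (use p pe one_edge_path[OF T _ v(2)] in blast)+
  then show fe: "first_edge T r v = e" by (simp add: first_edge_def)
  show "children T r r = {v}" "children T r v = {}"
    using v by (auto simp: children_def vT fe en)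
qed

text \<open>An edge with two distinct ends has incidence 1 and is listed exactly once at
  \<open>v\<close>. The other entries, among them loops listed twice, have positive length by
  \<open>pos\<close>.\<close>

lemma cyc_split:
  assumes fin: "finite_graph V" and cyc: "cyclic_orders V cyc" and v: "v \<in> verts V"
    and e: "e \<in> edges V" "ends V e = {v, w}" "v \<noteq> w"
    and pos: "\<forall>e'\<in>edges V - {e}. v \<in> ends V e' \<longrightarrow> 0 < dF e'"
  obtains l1 l2 where "cyc v = l1 @ e # l2" "e \<notin> set l1" "e \<notin> set l2"
    "length (cyc v) = valence V v" "\<forall>d\<in>set (map dF (l1 @ l2)). 0 < d"
proof -
  have cnt: "count_list (cyc v) e' = (if e' \<in> edges V then incidence V v e' else 0)" for e'
    using cyc v by (auto simp: cyclic_orders_def)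
  have "incidence V v e = 1" using e by (auto simp: incidence_def doubleton_eq_iff)
  then have "count_list (cyc v) e = 1" using cnt e by simp
  from count_list_1_split[OF this] obtain l1 l2
    where l: "cyc v = l1 @ e # l2" "e \<notin> set l1" "e \<notin> set l2" by blast
  have mem: "e' \<in> edges V \<and> v \<in> ends V e'" if "e' \<in> set (cyc v)" for e'
  proof -
    have "count_list (cyc v) e' \<noteq> 0" using that by (simp add: count_list_0_iff)
    then show ?thesis unfolding cnt by (auto simp: incidence_def split: if_splits)
  qed
  have "(\<Sum>e'\<in>edges V. count_list (cyc v) e') = length (cyc v)"
    by (rule sum_count_set) (use mem fin in \<open>auto simp: finite_graph_def\<close>)
  then have "length (cyc v) = valence V v" by (simp add: cnt valence_def)
  moreover have "0 < dF e'" if "e' \<in> set (l1 @ l2)" for e'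
    using mem[of e'] that l pos by auto
  ultimately show ?thesis using that[OF l] by auto
qed

theorem lemma5p9:
  fixes V T :: "('v, 'e) graph"
    and cyc :: "'v \<Rightarrow> 'e list"
    and vT v :: 'v and eT :: 'e
    and dF :: "'e \<Rightarrow> real"
  assumes "finite_graph V"
    and "\<forall>u\<in>verts V. 3 \<le> valence V u"
    and "cyclic_orders V cyc"
    and "subgraph T V"
    and "is_tree T"
    and "edges T = {eT}"
    and "vT \<in> verts T"
    and "v \<in> ends T eT - {vT}"
    and "\<forall>(e, u)\<in>frontier_pairs V T. 0 < dF e"
    and "Ad V cyc T vT dF \<noteq> {}"
  shows "\<exists>dm dp.
    dm < dp \<and>
    ((\<lambda>dE. dE eT) ` Ad V cyc T vT dF = {dm<..<dp} \<or>
     (\<lambda>dE. dE eT) ` Ad V cyc T vT dF = {dm..<dp}) \<and>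
    (let dE0 = (\<lambda>e\<in>edges T. dm); d0 = join T dE0 dF in
       (\<forall>R\<ge>0. is_arg_min (\<lambda>dE. D_tree R cyc T (join T dE dF))
                  (\<lambda>dE. dE \<in> Ad_closure V cyc T vT dF) dE0) \<and>
       (P cyc d0 v \<in> BC (valence V v) \<or> P cyc d0 vT \<in> BC (valence V vT)) \<and>
       (P cyc d0 vT \<in> BC (valence V vT) \<longrightarrow> dm \<noteq> Max (set (P cyc d0 vT))))"
proof -
  note sub = \<open>subgraph T V\<close>[unfolded subgraph_def] and T = \<open>edges T = {eT}\<close>
  have vv: "v \<in> verts T" "v \<noteq> vT" using sub T \<open>v \<in> ends T eT - {vT}\<close> by auto
  note tree = one_edge_tree[OF \<open>is_tree T\<close> T \<open>vT \<in> verts T\<close> vv]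
  have eV: "eT \<in> edges V" "ends V eT = {v, vT}" "ends V eT = {vT, v}"
    using sub T tree(1) by auto
  have vV: "v \<in> verts V" "vT \<in> verts V" using sub vv \<open>vT \<in> verts T\<close> by auto
  have pos: "0 < dF e" if "e \<in> edges V - {eT}" "u \<in> ends V e" "u \<in> verts T" for e u
  proof -
    have "(e, u) \<in> frontier_pairs V T" using that T by (auto simp: frontier_pairs_def)
    then show ?thesis using assms(9) by blast
  qed
  obtain l1 l2 where l: "cyc v = l1 @ eT # l2" "eT \<notin> set l1" "eT \<notin> set l2"
    "length (cyc v) = valence V v" "\<forall>d\<in>set (map dF (l1 @ l2)). 0 < d"
    using cyc_split[OF assms(1,3) vV(1) eV(1,2) vv(2), of dF] pos vv(1) by blast
  obtain m1 m2 where m: "cyc vT = m1 @ eT # m2" "eT \<notin> set m1" "eT \<notin> set m2"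
    "length (cyc vT) = valence V vT" "\<forall>d\<in>set (map dF (m1 @ m2)). 0 < d"
    using cyc_split[OF assms(1,3) vV(2) eV(1,3) vv(2)[symmetric], of dF] pos \<open>vT \<in> verts T\<close> by blast
  have val: "3 \<le> valence V v" "3 \<le> valence V vT" using assms(2) vV by auto
  interpret split_edge "map dF l1" "map dF l2" "map dF m1" "map dF m2"
    by unfold_locales (use l m val in auto)
  have Pv: "P cyc (join T dE dF) v = ini_sides (dE eT)" for dE
    using l(2,3) by (auto simp: P_def l(1) join_def T)
  have PT: "P cyc (join T dE dF) vT = root_sides (dE eT)" for dE
    using m(2,3) by (auto simp: P_def m(1) join_def T)
  have len: "valence V v = length (ini_sides x)" "valence V vT = length (root_sides x)" for x
    using l(1,4) m(1,4) by auto
  have Ad: "Ad V cyc T vT dF = {dE \<in> edges T \<rightarrow>\<^sub>E UNIV. admissible (dE eT)}"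
  proof -
    have vset: "verts T - {vT} = {v}" using tree(2) vv(2) by auto
    have join: "join T dE dF eT = dE eT" for dE by (simp add: join_def T)
    have kids: "(\<forall>u\<in>verts T. \<forall>w\<in>children T vT u. J (P cyc d w) < J (P cyc d u)) \<longleftrightarrow>
        J (P cyc d v) < J (P cyc d vT)" for d
      by (simp only: tree(2)) (simp add: tree(4,5))
    have adm: "admissible x \<longleftrightarrow> ini_sides x \<in> AC (valence V v) - C (valence V v) \<and>
        x = Max (set (ini_sides x)) \<and> root_sides x \<in> C (valence V vT) \<and>
        J (ini_sides x) < J (root_sides x)" for x
      unfolding len(1)[of x] len(2)[of x] by (rule admissible_iff)
    show ?thesis
      unfolding Ad_def Let_def vset kids by (simp only: ball_simps tree(3) Pv PT join adm) blast
  qed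
  obtain dE1 where "admissible (dE1 eT)" using assms(10) Ad by auto
  from admissible_interval[OF this] obtain dm dp where d: "dm < dp"
    and cases: "Collect admissible = {dm<..<dp} \<and> dm < Max (set (map dF m1 @ map dF m2)) \<and>
       angs (map dF m1 @ map dF m2) (Max (set (map dF m1 @ map dF m2)) / 2)
         + ang dm (Max (set (map dF m1 @ map dF m2)) / 2) = 2 * pi \<or>
     Collect admissible = {dm..<dp} \<and> angs (map dF l1 @ map dF l2) (dm / 2) = pi"
    and ex: "\<And>x. dm \<le> x \<Longrightarrow> x \<le> dp \<Longrightarrow> \<exists>j k. radii x j k \<and> k \<le> j"
    and le: "\<And>x j k j' k'. dm \<le> x \<Longrightarrow> x \<le> dp \<Longrightarrow> radii dm j k \<Longrightarrow> radii x j' k' \<Longrightarrow>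
      total x j' k' \<le> total dm j k"
    by blast
  define c where "c x = (\<lambda>e\<in>edges T. x)" for x :: real
  have c: "c x \<in> edges T \<rightarrow>\<^sub>E UNIV" "c x eT = x" for x by (auto simp: c_def T)
  have "x \<in> (\<lambda>dE. dE eT) ` Ad V cyc T vT dF" if "admissible x" for x
    by (rule image_eqI[of _ _ "c x"]) (use that c in \<open>auto simp: Ad\<close>)
  then have img: "(\<lambda>dE. dE eT) ` Ad V cyc T vT dF = Collect admissible" by (auto simp: Ad)
  have "Collect admissible = {dm<..<dp} \<or> Collect admissible = {dm..<dp}" using cases by blast
  then have adm_sub: "{dm<..<dp} \<subseteq> Collect admissible" "Collect admissible \<subseteq> {dm..dp}"
    by (elim disjE; simp only:; force)+
  \<comment> \<open>A coordinate map is continuous, so lying in \<open>{dm..dp}\<close> is a closed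
    condition and passes to the closure.\<close>
  have bounds: "dm \<le> dE eT \<and> dE eT \<le> dp" if "dE \<in> Ad_closure V cyc T vT dF" for dE
  proof -
    have "closedin (powertop_real (edges T)) {f \<in> topspace (powertop_real (edges T)). f eT \<in> {dm..dp}}"
      by (rule closedin_continuous_map_preimage[OF continuous_map_product_projection]) (auto simp: T)
    moreover have "Ad V cyc T vT dF \<subseteq> {f \<in> topspace (powertop_real (edges T)). f eT \<in> {dm..dp}}"
    proof
      fix f assume f: "f \<in> Ad V cyc T vT dF"
      then have "f eT \<in> Collect admissible" by (simp add: Ad)
      then have "f eT \<in> {dm..dp}" using adm_sub(2) by blast
      then show "f \<in> {f \<in> topspace (powertop_real (edges T)). f eT \<in> {dm..dp}}"
        using f by (auto simp: Ad)
    qed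
    ultimately have "Ad_closure V cyc T vT dF \<subseteq> {f \<in> topspace (powertop_real (edges T)). f eT \<in> {dm..dp}}"
      unfolding Ad_closure_def by (intro closure_of_minimal)
    then show ?thesis using that by auto
  qed
  \<comment> \<open>\<open>dm\<close> may be missing from the interval; it is a limit of admissible
    lengths on the real line, and the continuous map \<open>c\<close> transports this to the
    function space.\<close>
  have dm_closure: "c dm \<in> Ad_closure V cyc T vT dF"
  proof -
    have cont: "continuous_map euclideanreal (powertop_real (edges T)) c"
      unfolding continuous_map_componentwise by (auto simp: c_def T)
    have "dm \<in> closure (Collect admissible)"
      using closure_mono[OF adm_sub(1)] d by auto
    then have "c dm \<in> c ` (euclideanreal closure_of Collect admissible)" by simp
    also have "\<dots> \<subseteq> powertop_real (edges T) closure_of (c ` Collect admissible)"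
      by (rule continuous_map_image_closure_subset[OF cont])
    also have "\<dots> \<subseteq> Ad_closure V cyc T vT dF"
      unfolding Ad_closure_def by (rule closure_of_mono) (use c in \<open>auto simp: Ad\<close>)
    finally show ?thesis .
  qed
  define K where "K = (real (valence V v) - 2) * pi + (real (valence V vT) - 2) * pi"
  have D: "D_tree R cyc T (join T dE dF) = K - cosh R * total (dE eT) j k"
    if "radii (dE eT) j k" for R dE j k
  proof -
    have "D_tree R cyc T (join T dE dF) =
        D_polygon R (ini_sides (dE eT)) + D_polygon R (root_sides (dE eT))"
      using vv(2) by (simp add: D_tree_def tree(2) Pv PT)
    also have "\<dots> = K - cosh R * total (dE eT) j k"
      unfolding radii_polygons(3)[OF that, symmetric] K_def D_polygon_angle_sum
        len(1)[of "dE eT"] len(2)[of "dE eT"]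
      by (simp add: algebra_simps)
    finally show ?thesis .
  qed
  \<comment> \<open>The radii exist at both endpoints even where these are not admissible, so
    \<open>D\<close> applies on the whole closure.\<close>
  obtain jm km where rm: "radii dm jm km" using ex[of dm] d by auto
  have argmin: "is_arg_min (\<lambda>dE. D_tree R cyc T (join T dE dF))
      (\<lambda>dE. dE \<in> Ad_closure V cyc T vT dF) (c dm)" for R
    unfolding is_arg_min_def
  proof (intro conjI dm_closure notI, elim exE conjE)
    fix f assume f: "f \<in> Ad_closure V cyc T vT dF"
      and lt: "D_tree R cyc T (join T f dF) < D_tree R cyc T (join T (c dm) dF)"
    have b: "dm \<le> f eT" "f eT \<le> dp" using bounds[OF f] by auto
    then obtain j k where r: "radii (f eT) j k" using ex by blast
    have "D_tree R cyc T (join T (c dm) dF) = K - cosh R * total dm jm km"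
      using D[of "c dm" jm km R] rm c by simp
    moreover have "cosh R * total (f eT) j k \<le> cosh R * total dm jm km"
      by (intro mult_left_mono le[OF b rm r]) simp
    ultimately show False using lt D[of f j k R] r by linarith
  qed
  have BC: "(P cyc (join T (c dm) dF) v \<in> BC (valence V v) \<or>
      P cyc (join T (c dm) dF) vT \<in> BC (valence V vT)) \<and>
      (P cyc (join T (c dm) dF) vT \<in> BC (valence V vT) \<longrightarrow> dm \<noteq> Max (set (P cyc (join T (c dm) dF) vT)))"
    using cases
  proof (elim disjE conjE)
    assume "dm < Max (set (map dF m1 @ map dF m2))"
      "angs (map dF m1 @ map dF m2) (Max (set (map dF m1 @ map dF m2)) / 2)
         + ang dm (Max (set (map dF m1 @ map dF m2)) / 2) = 2 * pi"
    from root_sides_in_BC[OF _ this] show ?thesis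
      using radii_pos[OF rm] unfolding Pv PT c len(2)[of dm] by blast
  next
    assume "Collect admissible = {dm..<dp}" and pi: "angs (map dF l1 @ map dF l2) (dm / 2) = pi"
    \<comment> \<open>In the half-open case the root polygon at \<open>dm\<close> lies in
      \<open>C\<close>, hence not in \<open>BC\<close>, and the claim about its largest side is
      vacuous.\<close>
    then have "admissible dm" using d by auto
    from admissible_root_not_BC[OF this] have "P cyc (join T (c dm) dF) vT \<notin> BC (valence V vT)"
      unfolding PT c .
    moreover from ini_sides_in_BC[OF rm pi] have "P cyc (join T (c dm) dF) v \<in> BC (valence V v)"
      unfolding Pv c len(1)[of dm] .
    ultimately show ?thesis by blast
  qed
  show ?thesis
    unfolding Let_def c_def[symmetric] img
    using d cases argmin BC by blast
qed

end
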